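(* Let $M$ be a smooth submanifold immersed in $\mathbb{R}^n$, let $m\in M$, and let $\exp_m$ be the exponential map of $M$ at $m$ (for the induced Riemannian metric), defined on a neighborhood of $0\in T_mM$ and regarded as a map into $\mathbb{R}^n$. Let $(t_1,\dots,t_k)$ be an orthonormal basis of $T_mM$. Then, as $x\to 0$ in $T_mM$, $$\exp_m(x)= m + x + \frac12\alpha_m(x,x)- \frac16\sum_{i=1}^k \big(\alpha_m(t_i,x)\cdot\alpha_m(x,x)\big)\,t_i+\frac16 (\nabla_x\alpha)(x,x)+O(|x|^4).$$
   Context: $D$ denotes the directional derivative in $\mathbb{R}^n$, $\cdot$ the Euclidean inner product, $N_mM$ the normal space of $M$ at $m$, and $X=X^\top+X^\bot$ the decomposition of $X\in T_m\mathbb{R}^n=T_mM\oplus N_mM$. The tangent connection is $\nabla^\top_XY=(D_XY)^\top$ (the Levi-Civita connection of $M$), and the normal connection is $\nabla^\bot_Xu=(D_Xu)^\bot$ for normal fields $u$. The second fundamental form is $\alpha(X,Y)=(D_XY)^\bot$, with values in the normal bundle, and its covariant derivative is $(\nabla_X\alpha)(Y,Z)=\nabla^\bot_X(\alpha(Y,Z))-\alpha(\nabla^\top_XY,Z)-\alpha(Y,\nabla^\top_XZ)$. *)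

theory Defs
  imports "HOL-Analysis.Analysis" "HOL-Library.Landau_Symbols"
begin

section \<open>Smooth maps between open subsets of normed spaces\<close>

text \<open>
  \<open>S\<close> is meant to be open. On a finite-dimensional domain, \<open>Ck_on n S f\<close> says that all
  iterated directional derivatives of order at most \<open>n\<close> exist and are continuous on \<open>S\<close>.
\<close>

primrec Ck_on ::
  "nat \<Rightarrow> 'a::real_normed_vector set \<Rightarrow> ('a \<Rightarrow> 'b::real_normed_vector) \<Rightarrow> bool" where
  "Ck_on 0 S f \<longleftrightarrow> continuous_on S f"
| "Ck_on (Suc n) S f \<longleftrightarrow>
     (\<forall>x\<in>S. f differentiable (at x)) \<and> (\<forall>v. Ck_on n S (\<lambda>x. frechet_derivative f (at x) v))"

definition smooth_on :: "'a::real_normed_vector set \<Rightarrow> ('a \<Rightarrow> 'b::real_normed_vector) \<Rightarrow> bool" where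
  "smooth_on S f \<longleftrightarrow> (\<forall>n. Ck_on n S f)"


section \<open>Immersed submanifolds\<close>

text \<open>
  An abstract manifold of dimension \<open>CARD('k)\<close> with a (not necessarily maximal) smooth atlas of
  charts \<open>(U, \<phi>)\<close>, together with a map into \<open>\<real>\<^sup>n\<close>, where \<open>n = CARD('n)\<close>. The map need not be
  injective, so points of the submanifold are points of the abstract manifold.
\<close>

record ('m, 'k::finite, 'n::finite) submanifold =
  mtop :: "'m topology"
  atlas :: "('m set \<times> ('m \<Rightarrow> real^'k)) set"
  imm :: "'m \<Rightarrow> real^'n"

definition smooth_manifold :: "'m topology \<Rightarrow> ('m set \<times> ('m \<Rightarrow> real^'k::finite)) set \<Rightarrow> bool" where
  "smooth_manifold X A \<longleftrightarrow>
     Hausdorff_space X \<and> second_countable X \<and>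
     (\<Union>(U, \<phi>)\<in>A. U) = topspace X \<and>
     (\<forall>(U, \<phi>)\<in>A. openin X U \<and> open (\<phi> ` U) \<and>
        homeomorphic_map (subtopology X U) (top_of_set (\<phi> ` U)) \<phi>) \<and>
     (\<forall>(U, \<phi>)\<in>A. \<forall>(V, \<psi>)\<in>A. smooth_on (\<phi> ` (U \<inter> V)) (\<psi> \<circ> inv_into U \<phi>))"

definition immersed_submanifold :: "('m, 'k::finite, 'n::finite) submanifold \<Rightarrow> bool" where
  "immersed_submanifold M \<longleftrightarrow>
     smooth_manifold (mtop M) (atlas M) \<and>
     (\<forall>(U, \<phi>)\<in>atlas M.
        smooth_on (\<phi> ` U) (imm M \<circ> inv_into U \<phi>) \<and>
        (\<forall>z\<in>\<phi> ` U. inj (frechet_derivative (imm M \<circ> inv_into U \<phi>) (at z))))"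


section \<open>Tangent and normal spaces\<close>

definition tangent_space :: "('m, 'k::finite, 'n::finite) submanifold \<Rightarrow> 'm \<Rightarrow> (real^'n) set" where
  "tangent_space M p = {x. \<exists>(U, \<phi>)\<in>atlas M. p \<in> U \<and>
     x \<in> range (frechet_derivative (imm M \<circ> inv_into U \<phi>) (at (\<phi> p)))}"

definition normal_space :: "('m, 'k::finite, 'n::finite) submanifold \<Rightarrow> 'm \<Rightarrow> (real^'n) set" where
  "normal_space M p = orthogonal_comp (tangent_space M p)"

definition tan_part :: "('m, 'k::finite, 'n::finite) submanifold \<Rightarrow> 'm \<Rightarrow> real^'n \<Rightarrow> real^'n" where
  "tan_part M p x = (THE y. y \<in> tangent_space M p \<and> x - y \<in> normal_space M p)"

definition nor_part :: "('m, 'k::finite, 'n::finite) submanifold \<Rightarrow> 'm \<Rightarrow> real^'n \<Rightarrow> real^'n" where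
  "nor_part M p x = (THE u. u \<in> normal_space M p \<and> x - u \<in> tangent_space M p)"


section \<open>Fields along the submanifold, and the induced connections\<close>

text \<open>
  A field is a map from the abstract manifold to \<open>\<real>\<^sup>n\<close>; only its germ at the point of interest
  matters.
\<close>

definition tangent_field_near ::
  "('m, 'k::finite, 'n::finite) submanifold \<Rightarrow> 'm \<Rightarrow> ('m \<Rightarrow> real^'n) \<Rightarrow> bool" where
  "tangent_field_near M p Y \<longleftrightarrow>
     (\<exists>W. openin (mtop M) W \<and> p \<in> W \<and>
        (\<forall>(U, \<phi>)\<in>atlas M. smooth_on (\<phi> ` (U \<inter> W)) (Y \<circ> inv_into U \<phi>)) \<and>
        (\<forall>q\<in>W. Y q \<in> tangent_space M q))"

text \<open>
  \<open>dir_deriv M p x Y\<close> is \<open>D\<^sub>x Y\<close> at \<open>p\<close>, for \<open>x\<close> tangent at \<open>p\<close>: pull \<open>x\<close> back to the vector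
  \<open>w\<close> in a chart and differentiate \<open>Y\<close> along \<open>w\<close>.
\<close>

definition dir_deriv ::
  "('m, 'k::finite, 'n::finite) submanifold \<Rightarrow> 'm \<Rightarrow> real^'n \<Rightarrow> ('m \<Rightarrow> real^'n) \<Rightarrow> real^'n" where
  "dir_deriv M p x Y =
     (THE v. \<exists>(U, \<phi>)\<in>atlas M. \<exists>w. p \<in> U \<and>
        x = frechet_derivative (imm M \<circ> inv_into U \<phi>) (at (\<phi> p)) w \<and>
        v = frechet_derivative (Y \<circ> inv_into U \<phi>) (at (\<phi> p)) w)"

definition tan_conn ::
  "('m, 'k::finite, 'n::finite) submanifold \<Rightarrow> 'm \<Rightarrow> real^'n \<Rightarrow> ('m \<Rightarrow> real^'n) \<Rightarrow> real^'n" where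
  "tan_conn M p x Y = tan_part M p (dir_deriv M p x Y)"

definition nor_conn ::
  "('m, 'k::finite, 'n::finite) submanifold \<Rightarrow> 'm \<Rightarrow> real^'n \<Rightarrow> ('m \<Rightarrow> real^'n) \<Rightarrow> real^'n" where
  "nor_conn M p x u = nor_part M p (dir_deriv M p x u)"


section \<open>The second fundamental form and its covariant derivative\<close>

text \<open>
  Both are tensorial, so their values at vectors \<open>x, y, z\<close> tangent at \<open>p\<close> are given by
  the formulas for fields, evaluated on any local tangent fields extending these vectors.
\<close>

definition second_ff ::
  "('m, 'k::finite, 'n::finite) submanifold \<Rightarrow> 'm \<Rightarrow> real^'n \<Rightarrow> real^'n \<Rightarrow> real^'n" where
  "second_ff M p x y =
     (THE v. \<exists>Y. tangent_field_near M p Y \<and> Y p = y \<and> v = nor_part M p (dir_deriv M p x Y))"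

definition cov_second_ff ::
  "('m, 'k::finite, 'n::finite) submanifold \<Rightarrow> 'm \<Rightarrow> real^'n \<Rightarrow> real^'n \<Rightarrow> real^'n \<Rightarrow> real^'n" where
  "cov_second_ff M p x y z =
     (THE v. \<exists>Y Z. tangent_field_near M p Y \<and> tangent_field_near M p Z \<and> Y p = y \<and> Z p = z \<and>
        v = nor_conn M p x (\<lambda>q. second_ff M q (Y q) (Z q))
            - second_ff M p (tan_conn M p x Y) (Z p)
            - second_ff M p (Y p) (tan_conn M p x Z))"


section \<open>Geodesics and the exponential map\<close>

definition smooth_curve ::
  "('m, 'k::finite, 'n::finite) submanifold \<Rightarrow> real set \<Rightarrow> (real \<Rightarrow> 'm) \<Rightarrow> bool" where
  "smooth_curve M I \<gamma> \<longleftrightarrow>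
     continuous_map (top_of_set I) (mtop M) \<gamma> \<and>
     (\<forall>(U, \<phi>)\<in>atlas M. smooth_on {t\<in>I. \<gamma> t \<in> U} (\<phi> \<circ> \<gamma>))"

definition velocity ::
  "('m, 'k::finite, 'n::finite) submanifold \<Rightarrow> (real \<Rightarrow> 'm) \<Rightarrow> real \<Rightarrow> real^'n" where
  "velocity M \<gamma> t = vector_derivative (imm M \<circ> \<gamma>) (at t)"

text \<open>
  Covariant derivative, for the tangent (Levi-Civita) connection, of a tangent field \<open>V\<close> along
  the curve \<open>\<gamma>\<close>.
\<close>

definition cov_deriv_along ::
  "('m, 'k::finite, 'n::finite) submanifold \<Rightarrow> (real \<Rightarrow> 'm) \<Rightarrow> (real \<Rightarrow> real^'n) \<Rightarrow> real \<Rightarrow> real^'n" where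
  "cov_deriv_along M \<gamma> V t = tan_part M (\<gamma> t) (vector_derivative V (at t))"

definition geodesic ::
  "('m, 'k::finite, 'n::finite) submanifold \<Rightarrow> real set \<Rightarrow> (real \<Rightarrow> 'm) \<Rightarrow> bool" where
  "geodesic M I \<gamma> \<longleftrightarrow>
     open I \<and> is_interval I \<and> smooth_curve M I \<gamma> \<and>
     (\<forall>t\<in>I. cov_deriv_along M \<gamma> (velocity M \<gamma>) t = 0)"

definition exp_reaches ::
  "('m, 'k::finite, 'n::finite) submanifold \<Rightarrow> 'm \<Rightarrow> real^'n \<Rightarrow> 'm \<Rightarrow> bool" where
  "exp_reaches M p x q \<longleftrightarrow>
     (\<exists>I \<gamma>. geodesic M I \<gamma> \<and> {0..1} \<subseteq> I \<and> \<gamma> 0 = p \<and> velocity M \<gamma> 0 = x \<and> \<gamma> 1 = q)"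

definition exp_domain :: "('m, 'k::finite, 'n::finite) submanifold \<Rightarrow> 'm \<Rightarrow> (real^'n) set" where
  "exp_domain M p = {x \<in> tangent_space M p. \<exists>q. exp_reaches M p x q}"

definition exp_map :: "('m, 'k::finite, 'n::finite) submanifold \<Rightarrow> 'm \<Rightarrow> real^'n \<Rightarrow> 'm" where
  "exp_map M p x = (THE q. exp_reaches M p x q)"

end

theory Submission
  imports Defs
begin

text \<open>
  Let \<open>y\<close> be the geodesic in the submanifold with \<open>y 0 = m\<close> and \<open>y' 0 = x\<close>. Then \<open>y 1\<close> is the image of
  \<open>x\<close> under the exponential map, and the asserted formula is the Taylor expansion of \<open>y\<close> at time 1
  with the derivatives at time 0 computed from the geodesic equation.

  The main device is the orthogonal projection \<open>P\<close> of the ambient space onto the tangent spaces, a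
  smooth matrix-valued function in a chart. A field \<open>Y\<close> is tangent if \<open>P Y = Y\<close>; differentiating this
  along a tangent vector \<open>x\<close> gives \<open>D\<^sub>x Y = (D\<^sub>x P) Y + P (D\<^sub>x Y)\<close>. Hence the second fundamental form is
  \<open>\<alpha>(x, Y) = (D\<^sub>x P) Y\<close>, which shows that it is tensorial (\<open>second_ff_chart\<close>). Since
  \<open>P P = P\<close>, the map \<open>D\<^sub>x P\<close> exchanges tangent and normal vectors, and one concludes that the covariant
  derivative of \<open>\<alpha>\<close> is the normal part of its directional derivative (\<open>cov_second_ff_chart\<close>).

  For a geodesic \<open>y''\<close> is normal, so \<open>y'' = \<alpha>(y', y')\<close>. Differentiating this once more gives the normal
  part \<open>(\<nabla>\<^sub>x \<alpha>)(x, x)\<close> of \<open>y'''\<close>, while differentiating \<open>P y'' = 0\<close> gives its tangential part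
  \<open>- (D\<^sub>x P) \<alpha>(x, x)\<close> (\<open>image_geodesic_derivatives\<close>). As \<open>P\<close> is symmetric, and as \<open>\<alpha>\<close> is symmetric by the symmetry
  of second derivatives, the coefficient of \<open>t\<^sub>i\<close> in the latter is \<open>- \<alpha>(t\<^sub>i, x) \<bullet> \<alpha>(x, x)\<close>.

  The error is uniform because the geodesic equation is homogeneous: the geodesic with a short
  initial velocity is one with an initial velocity of fixed length, run slowly. The latter exist on a
  common time interval, by the Picard-Lindeloef theorem with a time uniform in the initial value, and
  their fourth derivatives have a common bound; slowing down by the factor \<open>s\<close> multiplies the fourth
  derivative by \<open>s ^ 4\<close> (\<open>geodesic_family\<close>). Finally, the exponential map is a definite description
  ranging over all geodesics on the manifold, also those that leave the chart, so uniqueness is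
  proved by a connectedness argument that uses the Hausdorff property (\<open>geodesic_unique\<close>).
\<close>

section \<open>Calculus of continuously differentiable maps\<close>

lemma Ck_on_cong:
  assumes "open S" "\<And>x. x \<in> S \<Longrightarrow> f x = g x" "Ck_on n S f"
  shows "Ck_on n S g"
  using assms(2,3)
proof (induction n arbitrary: f g)
  case 0
  show ?case using continuous_on_cong[of S S f g] 0 by simp
next
  case (Suc n)
  have der: "(g has_derivative frechet_derivative f (at x)) (at x)" if "x \<in> S" for x
    using Suc.prems that has_derivative_transform_within_open[OF _ \<open>open S\<close> that, of f _ UNIV g]
    by (simp add: frechet_derivative_works)
  have eq: "frechet_derivative f (at x) v = frechet_derivative g (at x) v" if "x \<in> S" for x v
    using frechet_derivative_at[OF der[OF that]] by simp
  have "Ck_on n S (\<lambda>x. frechet_derivative g (at x) v)" for v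
  proof (rule Suc.IH)
    show "Ck_on n S (\<lambda>x. frechet_derivative f (at x) v)" using Suc.prems by simp
  qed (rule eq)
  moreover have "\<forall>x\<in>S. g differentiable (at x)"
    using der by (auto intro: differentiableI)
  ultimately show ?case by simp
qed

lemma Ck_on_SucI:
  assumes "open S" "\<And>x. x \<in> S \<Longrightarrow> (f has_derivative f' x) (at x)"
    and "\<And>v. Ck_on n S (\<lambda>x. f' x v)"
  shows "Ck_on (Suc n) S f"
proof -
  have eq: "f' x v = frechet_derivative f (at x) v" if "x \<in> S" for x v
    using frechet_derivative_at[OF assms(2)[OF that]] by simp
  have "Ck_on n S (\<lambda>x. frechet_derivative f (at x) v)" for v
    by (rule Ck_on_cong[OF \<open>open S\<close> eq assms(3)])
  moreover have "\<forall>x\<in>S. f differentiable (at x)"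
    using assms(2) by (auto intro: differentiableI)
  ultimately show ?thesis by simp
qed

lemma Ck_on_has_derivative:
  "Ck_on (Suc n) S f \<Longrightarrow> x \<in> S \<Longrightarrow> (f has_derivative frechet_derivative f (at x)) (at x)"
  by (simp add: frechet_derivative_works)

lemma Ck_on_SucD: "Ck_on (Suc n) S f \<Longrightarrow> Ck_on n S f"
proof (induction n arbitrary: f)
  case 0
  then show ?case
    by (auto intro!: continuous_at_imp_continuous_on differentiable_imp_continuous_within)
next
  case (Suc n)
  have "Ck_on n S (\<lambda>x. frechet_derivative f (at x) v)" for v
    by (rule Suc.IH) (use Suc.prems in \<open>simp\<close>)
  then show ?case using Suc.prems by simp
qed

lemma Ck_on_derivative: "Ck_on (Suc n) S f \<Longrightarrow> Ck_on n S (\<lambda>x. frechet_derivative f (at x) v)"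
  by simp

lemma Ck_on_subset: "Ck_on n S f \<Longrightarrow> T \<subseteq> S \<Longrightarrow> Ck_on n T f"
  by (induction n arbitrary: f) (auto intro: continuous_on_subset)

lemma Ck_on_const [simp]: "Ck_on n S (\<lambda>_. c)"
  by (induction n arbitrary: c) auto

lemma Ck_on_ident:
  assumes "open S"
  shows "Ck_on n S (\<lambda>x. x)"
proof (cases n)
  case 0
  then show ?thesis by (simp add: continuous_on_id)
next
  case (Suc k)
  show ?thesis
    unfolding Suc by (rule Ck_on_SucI[OF \<open>open S\<close> has_derivative_ident]) simp
qed

lemma Ck_on_bounded_linear:
  assumes "open S" "bounded_linear L" "Ck_on n S f"
  shows "Ck_on n S (\<lambda>x. L (f x))"
  using assms(3)
proof (induction n arbitrary: f)
  case 0
  then show ?case using assms(2) by (simp add: bounded_linear.continuous_on)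
next
  case (Suc n)
  show ?case
  proof (rule Ck_on_SucI[OF \<open>open S\<close>])
    show "((\<lambda>x. L (f x)) has_derivative (\<lambda>v. L (frechet_derivative f (at x) v))) (at x)"
      if "x \<in> S" for x
      by (rule bounded_linear.has_derivative[OF assms(2) Ck_on_has_derivative[OF Suc.prems that]])
  qed (use Suc in auto)
qed

lemma Ck_on_add:
  assumes "open S" "Ck_on n S f" "Ck_on n S g"
  shows "Ck_on n S (\<lambda>x. f x + g x)"
  using assms(2,3)
proof (induction n arbitrary: f g)
  case 0
  then show ?case by (simp add: continuous_on_add)
next
  case (Suc n)
  show ?case
  proof (rule Ck_on_SucI[OF \<open>open S\<close>])
    show "((\<lambda>x. f x + g x) has_derivative
        (\<lambda>v. frechet_derivative f (at x) v + frechet_derivative g (at x) v)) (at x)"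
      if "x \<in> S" for x
      using Ck_on_has_derivative[OF Suc.prems(1) that] Ck_on_has_derivative[OF Suc.prems(2) that]
      by (rule has_derivative_add)
  qed (use Suc in auto)
qed

lemma Ck_on_bilinear:
  assumes "open S" "bounded_bilinear B" "Ck_on n S f" "Ck_on n S g"
  shows "Ck_on n S (\<lambda>x. B (f x) (g x))"
  using assms(3,4)
proof (induction n arbitrary: f g)
  case 0
  then show ?case using bounded_bilinear.continuous_on[OF assms(2)] by simp
next
  case (Suc n)
  show ?case
  proof (rule Ck_on_SucI[OF \<open>open S\<close>])
    show "((\<lambda>x. B (f x) (g x)) has_derivative
        (\<lambda>v. B (f x) (frechet_derivative g (at x) v) + B (frechet_derivative f (at x) v) (g x)))
        (at x)" if "x \<in> S" for x
      using Ck_on_has_derivative[OF Suc.prems(1) that] Ck_on_has_derivative[OF Suc.prems(2) that]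
      by (rule bounded_bilinear.FDERIV[OF assms(2)])
    show "Ck_on n S (\<lambda>x. B (f x) (frechet_derivative g (at x) v)
        + B (frechet_derivative f (at x) v) (g x))" for v
      by (intro Ck_on_add[OF \<open>open S\<close>] Suc.IH Ck_on_SucD[OF Suc.prems(1)]
          Ck_on_SucD[OF Suc.prems(2)] Ck_on_derivative[OF Suc.prems(1)]
          Ck_on_derivative[OF Suc.prems(2)])
  qed
qed

lemmas Ck_on_scaleR = Ck_on_bilinear[OF _ bounded_bilinear_scaleR]
lemmas Ck_on_mult = Ck_on_bilinear[OF _ bounded_bilinear_mult]
lemmas Ck_on_inner = Ck_on_bilinear[OF _ bounded_bilinear_inner]
lemmas Ck_on_minus = Ck_on_bounded_linear[OF _ bounded_linear_minus[OF bounded_linear_ident]]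

lemma Ck_on_sum:
  assumes "open S" "\<And>i. i \<in> I \<Longrightarrow> Ck_on n S (f i)"
  shows "Ck_on n S (\<lambda>x. \<Sum>i\<in>I. f i x)"
  using assms(2) by (induction I rule: infinite_finite_induct) (auto intro: Ck_on_add[OF \<open>open S\<close>])

lemma Ck_on_prod:
  fixes f :: "'i \<Rightarrow> 'a::real_normed_vector \<Rightarrow> real"
  assumes "open S" "\<And>i. i \<in> I \<Longrightarrow> Ck_on n S (f i)"
  shows "Ck_on n S (\<lambda>x. \<Prod>i\<in>I. f i x)"
  using assms(2) by (induction I rule: infinite_finite_induct) (auto intro: Ck_on_mult[OF \<open>open S\<close>])

text \<open>
  Tensor fields are handled below as families of linear maps \<open>Q u\<close> such that \<open>u \<mapsto> Q u b\<close> is smooth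
  for every fixed \<open>b\<close>. Expanding the argument in a basis reduces their calculus to products of
  scalar functions with functions of this kind, so no norm on spaces of linear maps is needed.
\<close>

lemma linear_basis_expansion:
  fixes L :: "'a::euclidean_space \<Rightarrow> 'b::real_vector"
  assumes "linear L"
  shows "L x = (\<Sum>b\<in>Basis. (x \<bullet> b) *\<^sub>R L b)"
  using linear_sum[OF assms, of "\<lambda>b. (x \<bullet> b) *\<^sub>R b" Basis]
  by (simp add: euclidean_representation linear_scale[OF assms])

lemma Ck_on_compose:
  fixes f :: "'a::real_normed_vector \<Rightarrow> 'b::euclidean_space" and g :: "'b \<Rightarrow> 'c::real_normed_vector"
  assumes "open S" "Ck_on n S f" "Ck_on n T g" "f ` S \<subseteq> T"
  shows "Ck_on n S (\<lambda>x. g (f x))"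
  using assms(2,3)
proof (induction n arbitrary: g)
  case 0
  then show ?case using assms(4) by (auto intro: continuous_on_compose2)
next
  case (Suc n)
  let ?D = "frechet_derivative"
  show ?case
  proof (rule Ck_on_SucI[OF \<open>open S\<close>])
    fix x assume "x \<in> S"
    then have "f x \<in> T" using assms(4) by auto
    then have g: "(g has_derivative ?D g (at (f x))) (at (f x))"
      using Ck_on_has_derivative Suc.prems by blast
    have "((\<lambda>x. g (f x)) has_derivative (\<lambda>v. ?D g (at (f x)) (?D f (at x) v))) (at x)"
      using Ck_on_has_derivative[OF Suc.prems(1) \<open>x \<in> S\<close>] g by (rule has_derivative_compose)
    moreover have "?D g (at (f x)) (?D f (at x) v)
        = (\<Sum>b\<in>Basis. (?D f (at x) v \<bullet> b) *\<^sub>R ?D g (at (f x)) b)" for v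
      using g by (intro linear_basis_expansion has_derivative_linear)
    ultimately show "((\<lambda>x. g (f x)) has_derivative
        (\<lambda>v. \<Sum>b\<in>Basis. (?D f (at x) v \<bullet> b) *\<^sub>R ?D g (at (f x)) b)) (at x)" by simp
  next
    fix v
    have "Ck_on n S f" "Ck_on n S (\<lambda>x. ?D f (at x) v)" "\<And>b. Ck_on n T (\<lambda>x. ?D g (at x) b)"
      using Suc.prems Ck_on_SucD by (blast, simp_all)
    then show "Ck_on n S (\<lambda>x. \<Sum>b\<in>Basis. (?D f (at x) v \<bullet> b) *\<^sub>R ?D g (at (f x)) b)"
      by (intro Ck_on_sum Ck_on_scaleR Ck_on_inner Suc.IH Ck_on_const \<open>open S\<close>)
  qed
qed

lemma Ck_on_linear_family:
  fixes Q :: "'a::real_normed_vector \<Rightarrow> 'b::euclidean_space \<Rightarrow> 'c::real_normed_vector"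
  assumes "open S" "\<And>b. Ck_on n S (\<lambda>u. Q u b)" "\<And>u. u \<in> S \<Longrightarrow> linear (Q u)" "Ck_on n S y"
  shows "Ck_on n S (\<lambda>u. Q u (y u))"
proof (rule Ck_on_cong[OF \<open>open S\<close>])
  show "(\<Sum>b\<in>Basis. (y u \<bullet> b) *\<^sub>R Q u b) = Q u (y u)" if "u \<in> S" for u
    by (rule linear_basis_expansion[OF assms(3)[OF that], symmetric])
  show "Ck_on n S (\<lambda>u. \<Sum>b\<in>Basis. (y u \<bullet> b) *\<^sub>R Q u b)"
    using assms by (intro Ck_on_sum Ck_on_scaleR Ck_on_inner) auto
qed

lemma frechet_linear_family_linear:
  fixes Q :: "'a::real_normed_vector \<Rightarrow> 'b::real_vector \<Rightarrow> 'c::real_normed_vector"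
  assumes "open S" "u \<in> S" "\<And>b. (\<lambda>u. Q u b) differentiable (at u)" "\<And>u. u \<in> S \<Longrightarrow> linear (Q u)"
  shows "linear (\<lambda>b. frechet_derivative (\<lambda>u. Q u b) (at u) w)"
proof (rule linearI)
  let ?D = "\<lambda>b. frechet_derivative (\<lambda>u. Q u b) (at u)"
  have D: "((\<lambda>u. Q u b) has_derivative ?D b) (at u)" for b
    using assms(3) frechet_derivative_works by blast
  have "((\<lambda>u. Q u (a + b)) has_derivative (\<lambda>w. ?D a w + ?D b w)) (at u)" for a b
    using has_derivative_add[OF D D]
    by (rule has_derivative_transform_within_open[OF _ \<open>open S\<close> \<open>u \<in> S\<close>])
      (simp add: linear_add[OF assms(4)])
  from frechet_derivative_at[OF this]
  show "?D (a + b) w = ?D a w + ?D b w" for a b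
    by (simp add: fun_eq_iff)
  have "((\<lambda>u. Q u (r *\<^sub>R a)) has_derivative (\<lambda>w. r *\<^sub>R ?D a w)) (at u)" for a r
    using has_derivative_scaleR_right[OF D]
    by (rule has_derivative_transform_within_open[OF _ \<open>open S\<close> \<open>u \<in> S\<close>])
      (simp add: linear_scale[OF assms(4)])
  from frechet_derivative_at[OF this]
  show "?D (r *\<^sub>R a) w = r *\<^sub>R ?D a w" for a r
    by (simp add: fun_eq_iff)
qed

text \<open>
  The product rule for \<open>Q (c x) (y x)\<close>. It is applied both to fields, with \<open>c\<close> the identity, and
  along curves.
\<close>

lemma has_derivative_linear_family:
  fixes Q :: "'a::real_normed_vector \<Rightarrow> 'b::euclidean_space \<Rightarrow> 'c::real_normed_vector"
  assumes "open S" "c x \<in> S" "\<And>b. (\<lambda>u. Q u b) differentiable (at (c x))"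
    "\<And>u. u \<in> S \<Longrightarrow> linear (Q u)"
    and c: "(c has_derivative c') (at x)" and y: "(y has_derivative y') (at x)"
  shows "((\<lambda>x. Q (c x) (y x)) has_derivative
    (\<lambda>h. frechet_derivative (\<lambda>u. Q u (y x)) (at (c x)) (c' h) + Q (c x) (y' h))) (at x)"
proof -
  let ?D = "\<lambda>b. frechet_derivative (\<lambda>u. Q u b) (at (c x))"
  have D: "((\<lambda>x. Q (c x) b) has_derivative (\<lambda>h. ?D b (c' h))) (at x)" for b
    using has_derivative_compose[OF c] assms(3) frechet_derivative_works by blast
  have "((\<lambda>x. \<Sum>b\<in>Basis. (y x \<bullet> b) *\<^sub>R Q (c x) b) has_derivative
     (\<lambda>h. \<Sum>b\<in>Basis. (y x \<bullet> b) *\<^sub>R ?D b (c' h) + (y' h \<bullet> b) *\<^sub>R Q (c x) b)) (at x)"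
    using y by (auto intro!: derivative_eq_intros D)
  moreover have "(\<Sum>b\<in>Basis. (y x \<bullet> b) *\<^sub>R ?D b (c' h) + (y' h \<bullet> b) *\<^sub>R Q (c x) b)
      = ?D (y x) (c' h) + Q (c x) (y' h)" for h
    using linear_basis_expansion[OF frechet_linear_family_linear[OF assms(1,2,3,4)], of "y x" "c' h"]
      linear_basis_expansion[OF assms(4)[OF assms(2)], of "y' h"]
    by (simp add: sum.distrib)
  ultimately have *: "((\<lambda>x. \<Sum>b\<in>Basis. (y x \<bullet> b) *\<^sub>R Q (c x) b) has_derivative
     (\<lambda>h. ?D (y x) (c' h) + Q (c x) (y' h))) (at x)" by simp
  have "eventually (\<lambda>x. c x \<in> S) (at x)"
    using topological_tendstoD[OF _ assms(1,2)] has_derivative_continuous[OF c]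
    by (auto simp: continuous_at)
  then have "\<forall>\<^sub>F x' in at x. (\<Sum>b\<in>Basis. (y x' \<bullet> b) *\<^sub>R Q (c x') b) = Q (c x') (y x')"
    by (rule eventually_mono) (rule linear_basis_expansion[OF assms(4), symmetric])
  then show ?thesis
    by (rule has_derivative_transform_eventually[OF *])
      (simp_all add: linear_basis_expansion[OF assms(4)[OF assms(2)], symmetric])
qed

lemma smooth_onD: "smooth_on S f \<Longrightarrow> Ck_on n S f"
  by (simp add: smooth_on_def)

lemma smooth_on_derivative: "smooth_on S f \<Longrightarrow> smooth_on S (\<lambda>x. frechet_derivative f (at x) v)"
  unfolding smooth_on_def by (blast intro: Ck_on_derivative)

lemma smooth_on_differentiable: "smooth_on S f \<Longrightarrow> x \<in> S \<Longrightarrow> f differentiable (at x)"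
  using smooth_onD[of S f "Suc 0"] by simp

lemma smooth_on_has_derivative:
  "smooth_on S f \<Longrightarrow> x \<in> S \<Longrightarrow> (f has_derivative frechet_derivative f (at x)) (at x)"
  using smooth_on_differentiable[of S f x] by (simp add: frechet_derivative_works)

lemma smooth_on_continuous_on: "smooth_on S f \<Longrightarrow> continuous_on S f"
  using smooth_onD[of S f 0] by simp

lemma smooth_on_subset: "smooth_on S f \<Longrightarrow> T \<subseteq> S \<Longrightarrow> smooth_on T f"
  unfolding smooth_on_def using Ck_on_subset by blast

lemma smooth_on_compose:
  fixes f :: "'a::real_normed_vector \<Rightarrow> 'b::euclidean_space"
  shows "open S \<Longrightarrow> smooth_on S f \<Longrightarrow> smooth_on T g \<Longrightarrow> f ` S \<subseteq> T \<Longrightarrow> smooth_on S (\<lambda>x. g (f x))"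
  unfolding smooth_on_def using Ck_on_compose by blast

lemma smooth_on_linear_family:
  fixes Q :: "'a::real_normed_vector \<Rightarrow> 'b::euclidean_space \<Rightarrow> 'c::real_normed_vector"
  shows "open S \<Longrightarrow> (\<And>b. smooth_on S (\<lambda>u. Q u b)) \<Longrightarrow> (\<And>u. u \<in> S \<Longrightarrow> linear (Q u)) \<Longrightarrow>
    smooth_on S y \<Longrightarrow> smooth_on S (\<lambda>u. Q u (y u))"
  unfolding smooth_on_def using Ck_on_linear_family by blast

lemma Ck_on_inverse:
  "Ck_on n {x::real. x \<noteq> 0} inverse"
proof -
  have op: "open {x::real. x \<noteq> 0}" by (simp add: open_Collect_neq continuous_on_id)
  show ?thesis
  proof (induction n)
    case 0
    then show ?case by (simp add: continuous_on_inverse continuous_on_id)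
  next
    case (Suc n)
    show ?case
    proof (rule Ck_on_SucI[OF op])
      show "(inverse has_derivative (\<lambda>v. - (inverse x * v * inverse x))) (at x)"
        if "x \<in> {x. x \<noteq> 0}" for x :: real
        using has_derivative_inverse'[of x] that by simp
      show "Ck_on n {x::real. x \<noteq> 0} (\<lambda>x. - (inverse x * v * inverse x))" for v
        using Suc by (intro Ck_on_minus Ck_on_mult op) auto
    qed
  qed
qed

lemma Ck_on_divide:
  fixes f g :: "'a::real_normed_vector \<Rightarrow> real"
  assumes "open S" "Ck_on n S f" "Ck_on n S g" "\<And>x. x \<in> S \<Longrightarrow> g x \<noteq> 0"
  shows "Ck_on n S (\<lambda>x. f x / g x)"
proof -
  have "Ck_on n S (\<lambda>x. inverse (g x))"
    using assms by (intro Ck_on_compose[OF _ _ Ck_on_inverse]) auto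
  then show ?thesis
    using assms Ck_on_mult by (fastforce simp: divide_inverse)
qed

lemma Ck_on_det:
  fixes A :: "'a::real_normed_vector \<Rightarrow> real^'k^'k"
  assumes "open S" "\<And>i j. Ck_on n S (\<lambda>u. A u $ i $ j)"
  shows "Ck_on n S (\<lambda>u. det (A u))"
  unfolding det_def using assms by (intro Ck_on_sum Ck_on_mult Ck_on_prod) auto

lemma Ck_on_vec:
  fixes g :: "'k::finite \<Rightarrow> 'a::real_normed_vector \<Rightarrow> real"
  assumes "open S" "\<And>i. Ck_on n S (g i)"
  shows "Ck_on n S (\<lambda>u. \<chi> i. g i u)"
proof -
  have "(\<chi> i. g i u) = (\<Sum>i\<in>UNIV. g i u *\<^sub>R axis i 1)" for u
    by (simp add: vec_eq_iff axis_def if_distrib[of "(*) _"] cong: if_cong)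
  then show ?thesis
    using assms by (auto intro!: Ck_on_sum Ck_on_scaleR)
qed

lemma Ck_on_Pair:
  assumes "open S" "Ck_on n S f" "Ck_on n S g"
  shows "Ck_on n S (\<lambda>x. (f x, g x))"
proof -
  have "bounded_linear (\<lambda>a. (a, 0))" "bounded_linear (\<lambda>b. (0, b))"
    by (auto intro!: bounded_linear_Pair bounded_linear_ident bounded_linear_zero)
  then have "Ck_on n S (\<lambda>x. (f x, 0) + (0, g x))"
    using assms by (intro Ck_on_add Ck_on_bounded_linear[of S "\<lambda>a. (a, 0)"]
        Ck_on_bounded_linear[of S "\<lambda>b. (0, b)"])
  then show ?thesis by simp
qed

text \<open>
  Absorbing the last argument into the base point turns a bilinear family over \<open>S\<close> into a linear
  family over \<open>S \<times> UNIV\<close>, to which the linear product rule applies.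
\<close>

lemma has_derivative_bilinear_family:
  fixes A :: "'a::real_normed_vector \<Rightarrow> 'b::euclidean_space \<Rightarrow> 'c::euclidean_space \<Rightarrow> 'd::real_normed_vector"
  assumes "open S" "c s \<in> S" and diff: "\<And>u x y. u \<in> S \<Longrightarrow> (\<lambda>u. A u x y) differentiable (at u)"
    and lin1: "\<And>u y. u \<in> S \<Longrightarrow> linear (\<lambda>x. A u x y)" and lin2: "\<And>u x. u \<in> S \<Longrightarrow> linear (A u x)"
    and c: "(c has_derivative c') (at s)" and x: "(x has_derivative x') (at s)"
    and y: "(y has_derivative y') (at s)"
  shows "((\<lambda>s. A (c s) (x s) (y s)) has_derivative
    (\<lambda>h. frechet_derivative (\<lambda>u. A u (x s) (y s)) (at (c s)) (c' h)
       + A (c s) (x' h) (y s) + A (c s) (x s) (y' h))) (at s)"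
proof -
  let ?Q = "\<lambda>p x. A (fst p) x (snd p)"
  have op: "open (S \<times> (UNIV :: 'c set))" using assms(1) by (rule open_Times) simp
  have Qd: "((\<lambda>p. ?Q p b) has_derivative (\<lambda>h. frechet_derivative (\<lambda>u. A u b (snd p)) (at (fst p)) (fst h)
       + A (fst p) b (snd h))) (at p)" if "p \<in> S \<times> UNIV" for p b
    by (rule has_derivative_linear_family[OF assms(1), where Q="\<lambda>u. A u b"])
      (use that diff lin2 in \<open>auto intro!: derivative_eq_intros\<close>)
  have "((\<lambda>s. ?Q (c s, y s) (x s)) has_derivative
     (\<lambda>h. frechet_derivative (\<lambda>p. ?Q p (x s)) (at (c s, y s)) (c' h, y' h) + ?Q (c s, y s) (x' h))) (at s)"
  proof (rule has_derivative_linear_family[OF op, where Q="?Q" and c="\<lambda>s. (c s, y s)"])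
    show "(\<lambda>p. ?Q p b) differentiable (at (c s, y s))" for b
      using Qd[of "(c s, y s)" b] assms(2) by (intro differentiableI) auto
  qed (use assms(2) lin1 x in \<open>auto intro!: has_derivative_Pair c y\<close>)
  moreover have "frechet_derivative (\<lambda>p. ?Q p (x s)) (at (c s, y s)) =
     (\<lambda>h. frechet_derivative (\<lambda>u. A u (x s) (y s)) (at (c s)) (fst h) + A (c s) (x s) (snd h))"
    using frechet_derivative_at[OF Qd[of "(c s, y s)" "x s"]] assms(2) by simp
  ultimately show ?thesis by (simp add: algebra_simps)
qed

section \<open>Symmetry of the second derivative\<close>

text \<open>
  Both mixed second derivatives are limits of the same second difference quotient, because the
  second difference is symmetric in \<open>v\<close> and \<open>w\<close>. Two applications of the mean value theorem, first
  along \<open>v\<close> and then along \<open>w\<close>, express it exactly by a mixed derivative at a nearby point.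
\<close>

lemma second_difference_mvt:
  fixes f :: "'a::real_normed_vector \<Rightarrow> real"
  assumes "Ck_on (Suc (Suc 0)) (ball x e) f" "h > 0" "h * (norm v + norm w) < e"
  shows "\<exists>\<xi>\<in>ball x e. f (x + h *\<^sub>R v + h *\<^sub>R w) - f (x + h *\<^sub>R v) - f (x + h *\<^sub>R w) + f x
     = h\<^sup>2 * frechet_derivative (\<lambda>u. frechet_derivative f (at u) v) (at \<xi>) w"
proof -
  let ?D = frechet_derivative
  have inb: "x + s *\<^sub>R v + t *\<^sub>R w \<in> ball x e" if "0 \<le> s" "s \<le> h" "0 \<le> t" "t \<le> h" for s t
  proof -
    have "norm (s *\<^sub>R v + t *\<^sub>R w) \<le> s * norm v + t * norm w"
      using that norm_triangle_ineq[of "s *\<^sub>R v" "t *\<^sub>R w"] by simp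
    also have "\<dots> \<le> h * norm v + h * norm w"
      using that by (intro add_mono mult_right_mono) auto
    also have "\<dots> < e" using assms(3) by (simp add: algebra_simps)
    finally have "norm (s *\<^sub>R v + t *\<^sub>R w) < e" .
    moreover have "x - (x + s *\<^sub>R v + t *\<^sub>R w) = - (s *\<^sub>R v + t *\<^sub>R w)" by simp
    ultimately show ?thesis by (simp only: mem_ball dist_norm norm_minus_cancel)
  qed
  have df: "(f has_derivative ?D f (at u)) (at u)" if "u \<in> ball x e" for u
    by (rule Ck_on_has_derivative[OF assms(1) that])
  have ddf: "((\<lambda>u. ?D f (at u) v) has_derivative ?D (\<lambda>u. ?D f (at u) v) (at u)) (at u)"
    if "u \<in> ball x e" for u
    by (rule Ck_on_has_derivative[OF Ck_on_derivative[OF assms(1)] that])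
  have line: "((\<lambda>s. g (y + s *\<^sub>R z)) has_real_derivative ?D g (at (y + s *\<^sub>R z)) z) (at s)"
    if "(g has_derivative ?D g (at (y + s *\<^sub>R z))) (at (y + s *\<^sub>R z))"
    for g :: "'a \<Rightarrow> real" and y z s
  proof -
    have "((\<lambda>s. y + s *\<^sub>R z) has_derivative (\<lambda>r. r *\<^sub>R z)) (at s)"
      by (auto intro!: derivative_eq_intros)
    from has_derivative_compose[OF this that] show ?thesis
      by (rule has_derivative_imp_has_field_derivative)
        (simp add: linear_scale[OF has_derivative_linear[OF that]])
  qed
  define \<phi> where "\<phi> = (\<lambda>s. f ((x + h *\<^sub>R w) + s *\<^sub>R v) - f (x + s *\<^sub>R v))"
  have "\<exists>s>0. s < h \<and> \<phi> h - \<phi> 0 =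
      (h - 0) * (?D f (at ((x + h *\<^sub>R w) + s *\<^sub>R v)) v - ?D f (at (x + s *\<^sub>R v)) v)"
  proof (rule MVT2[OF \<open>h > 0\<close>])
    fix s assume s: "0 \<le> s" "s \<le> h"
    have "(x + h *\<^sub>R w) + s *\<^sub>R v \<in> ball x e" "x + s *\<^sub>R v \<in> ball x e"
      using inb[of s h] inb[of s 0] s \<open>h > 0\<close> by (auto simp: algebra_simps)
    then show "(\<phi> has_real_derivative
       ?D f (at ((x + h *\<^sub>R w) + s *\<^sub>R v)) v - ?D f (at (x + s *\<^sub>R v)) v) (at s)"
      unfolding \<phi>_def by (intro DERIV_diff line df)
  qed
  then obtain s where s: "0 < s" "s < h" and \<phi>: "\<phi> h - \<phi> 0 =
      h * (?D f (at ((x + s *\<^sub>R v) + h *\<^sub>R w)) v - ?D f (at ((x + s *\<^sub>R v) + 0 *\<^sub>R w)) v)"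
    by (auto simp: algebra_simps)
  define \<psi> where "\<psi> = (\<lambda>t. ?D f (at ((x + s *\<^sub>R v) + t *\<^sub>R w)) v)"
  have "\<exists>t>0. t < h \<and> \<psi> h - \<psi> 0 =
      (h - 0) * ?D (\<lambda>u. ?D f (at u) v) (at ((x + s *\<^sub>R v) + t *\<^sub>R w)) w"
    unfolding \<psi>_def
    by (rule MVT2[OF \<open>h > 0\<close>], rule line, rule ddf) (use inb s in auto)
  then obtain t where t: "0 < t" "t < h" and
    \<psi>: "\<psi> h - \<psi> 0 = h * ?D (\<lambda>u. ?D f (at u) v) (at ((x + s *\<^sub>R v) + t *\<^sub>R w)) w" by auto
  have "f (x + h *\<^sub>R v + h *\<^sub>R w) - f (x + h *\<^sub>R v) - f (x + h *\<^sub>R w) + f x = \<phi> h - \<phi> 0"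
    by (simp add: \<phi>_def algebra_simps)
  also have "\<dots> = h\<^sup>2 * ?D (\<lambda>u. ?D f (at u) v) (at ((x + s *\<^sub>R v) + t *\<^sub>R w)) w"
    using \<phi> \<psi> by (simp add: \<psi>_def power2_eq_square)
  finally show ?thesis using inb[of s t] s t by auto
qed

lemma second_derivative_symmetric_real:
  fixes f :: "'a::real_normed_vector \<Rightarrow> real"
  assumes "open S" "Ck_on (Suc (Suc 0)) S f" "x \<in> S"
  shows "frechet_derivative (\<lambda>u. frechet_derivative f (at u) v) (at x) w
       = frechet_derivative (\<lambda>u. frechet_derivative f (at u) w) (at x) v"
proof (rule ccontr)
  define a where "a = (\<lambda>v w u. frechet_derivative (\<lambda>u. frechet_derivative f (at u) v) (at u) w)"
  assume "\<not> ?thesis"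
  then have "a v w x \<noteq> a w v x" by (simp add: a_def)
  define \<eta> where "\<eta> = \<bar>a v w x - a w v x\<bar> / 2"
  have "\<eta> > 0" using \<open>a v w x \<noteq> a w v x\<close> by (simp add: \<eta>_def)
  have cont: "isCont (a v w) x" for v w
  proof -
    have "continuous_on S (a v w)"
      using assms(2) by (simp add: a_def)
    then show ?thesis using assms(1,3) continuous_on_eq_continuous_at by blast
  qed
  obtain e0 where e0: "e0 > 0" "ball x e0 \<subseteq> S"
    using assms(1,3) openE by blast
  have near: "\<exists>d>0. \<forall>u. dist u x < d \<longrightarrow> \<bar>a v w u - a v w x\<bar> < \<eta>" for v w
    using cont[of v w] \<open>\<eta> > 0\<close> unfolding continuous_at_eps_delta by (simp add: dist_real_def)
  obtain d1 where d1: "d1 > 0" "\<And>u. dist u x < d1 \<Longrightarrow> \<bar>a v w u - a v w x\<bar> < \<eta>"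
    using near[of v w] by auto
  obtain d2 where d2: "d2 > 0" "\<And>u. dist u x < d2 \<Longrightarrow> \<bar>a w v u - a w v x\<bar> < \<eta>"
    using near[of w v] by auto
  define e where "e = min e0 (min d1 d2)"
  have e: "e > 0" using e0 d1(1) d2(1) by (simp add: e_def)
  define h where "h = e / (norm v + norm w + 1)"
  have np: "norm v + norm w + 1 > 0" using norm_ge_zero[of v] norm_ge_zero[of w] by linarith
  then have h: "h > 0" using e by (simp add: h_def)
  have "h * (norm v + norm w) < h * (norm v + norm w + 1)" using h by simp
  also have "\<dots> = e" using np by (simp add: h_def)
  finally have hb: "h * (norm v + norm w) < e" "h * (norm w + norm v) < e" by (simp_all add: add.commute)
  have Ck: "Ck_on (Suc (Suc 0)) (ball x e) f"
    by (rule Ck_on_subset[OF assms(2)]) (use e0 in \<open>auto simp: e_def\<close>)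
  obtain \<xi> where \<xi>: "\<xi> \<in> ball x e" and 1: "f (x + h *\<^sub>R v + h *\<^sub>R w) - f (x + h *\<^sub>R v) - f (x + h *\<^sub>R w) + f x
      = h\<^sup>2 * a v w \<xi>"
    using second_difference_mvt[OF Ck h hb(1)] unfolding a_def by blast
  obtain \<zeta> where \<zeta>: "\<zeta> \<in> ball x e" and 2: "f (x + h *\<^sub>R w + h *\<^sub>R v) - f (x + h *\<^sub>R w) - f (x + h *\<^sub>R v) + f x
      = h\<^sup>2 * a w v \<zeta>"
    using second_difference_mvt[OF Ck h hb(2)] unfolding a_def by blast
  have "h\<^sup>2 * a v w \<xi> = h\<^sup>2 * a w v \<zeta>" using 1 2 by (simp add: algebra_simps)
  then have "a v w \<xi> = a w v \<zeta>" using h by simp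
  moreover have "\<bar>a v w \<xi> - a v w x\<bar> < \<eta>" "\<bar>a w v \<zeta> - a w v x\<bar> < \<eta>"
    using d1(2)[of \<xi>] d2(2)[of \<zeta>] \<xi> \<zeta> by (auto simp: e_def dist_commute)
  ultimately show False unfolding \<eta>_def by (simp add: abs_if field_simps split: if_splits)
qed

lemma frechet_derivative_bounded_linear:
  assumes "bounded_linear L" "f differentiable (at x)"
  shows "frechet_derivative (\<lambda>u. L (f u)) (at x) v = L (frechet_derivative f (at x) v)"
  using frechet_derivative_at[OF bounded_linear.has_derivative[OF assms(1)
    assms(2)[unfolded frechet_derivative_works]]] by metis

lemma second_derivative_symmetric:
  fixes f :: "'a::real_normed_vector \<Rightarrow> 'b::euclidean_space"
  assumes "open S" "Ck_on (Suc (Suc 0)) S f" "x \<in> S"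
  shows "frechet_derivative (\<lambda>u. frechet_derivative f (at u) v) (at x) w
       = frechet_derivative (\<lambda>u. frechet_derivative f (at u) w) (at x) v"
proof (rule euclidean_eqI)
  fix b :: 'b assume "b \<in> Basis"
  let ?D = frechet_derivative
  note bl = bounded_linear_inner_left[of b]
  have Ck: "Ck_on (Suc (Suc 0)) S (\<lambda>u. f u \<bullet> b)"
    using assms by (intro Ck_on_bounded_linear[OF _ bl])
  have *: "?D (\<lambda>u. ?D f (at u) v) (at x) w \<bullet> b
      = ?D (\<lambda>u. ?D (\<lambda>u. f u \<bullet> b) (at u) v) (at x) w" for v w
  proof -
    have dd: "(\<lambda>u. ?D f (at u) v) differentiable (at x)"
      using assms(2,3) by simp
    have "?D (\<lambda>u. ?D (\<lambda>u. f u \<bullet> b) (at u) v) (at x) = ?D (\<lambda>u. ?D f (at u) v \<bullet> b) (at x)"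
    proof (rule frechet_derivative_transform_within_open[OF _ assms(1,3)])
      show "?D (\<lambda>u. f u \<bullet> b) (at u) v = ?D f (at u) v \<bullet> b" if "u \<in> S" for u
        by (rule frechet_derivative_bounded_linear[OF bl]) (use assms(2) that in simp)
      show "(\<lambda>u. ?D (\<lambda>u. f u \<bullet> b) (at u) v) differentiable (at x)"
        using Ck assms(3) by simp
    qed
    then show ?thesis using frechet_derivative_bounded_linear[OF bl dd] by simp
  qed
  show "?D (\<lambda>u. ?D f (at u) v) (at x) w \<bullet> b = ?D (\<lambda>u. ?D f (at u) w) (at x) v \<bullet> b"
    unfolding * by (rule second_derivative_symmetric_real[OF assms(1) Ck assms(3)])
qed

section \<open>Autonomous differential equations and Taylor's formula\<close>

text \<open>
  Local Lipschitz continuity is what both the existence and the uniqueness theorem for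
  differential equations use of the vector field.
\<close>

lemma C1_locally_lipschitz:
  fixes G :: "'a::euclidean_space \<Rightarrow> 'b::real_normed_vector"
  assumes "open S" "Ck_on (Suc 0) S G" "x \<in> S"
  obtains r L where "r > 0" "L \<ge> 0" "cball x r \<subseteq> S"
    "\<And>u v. u \<in> cball x r \<Longrightarrow> v \<in> cball x r \<Longrightarrow> norm (G u - G v) \<le> L * norm (u - v)"
proof -
  let ?D = frechet_derivative
  obtain r where r: "r > 0" "cball x r \<subseteq> S"
    using assms(1,3) open_contains_cball by blast
  have "\<exists>K. \<forall>u\<in>cball x r. norm (?D G (at u) b) \<le> K" for b
  proof -
    have "continuous_on (cball x r) (\<lambda>u. ?D G (at u) b)"
      by (rule continuous_on_subset[OF _ r(2)]) (use assms(2) in simp)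
    then have "bounded ((\<lambda>u. ?D G (at u) b) ` cball x r)"
      by (intro compact_imp_bounded compact_continuous_image compact_cball)
    then show ?thesis by (auto simp: bounded_iff)
  qed
  then obtain K where K: "\<And>b u. u \<in> cball x r \<Longrightarrow> norm (?D G (at u) b) \<le> K b" by metis
  have der: "(G has_derivative ?D G (at u)) (at u)" if "u \<in> cball x r" for u
    using Ck_on_has_derivative[OF assms(2)] that r by blast
  have on: "onorm (?D G (at u)) \<le> (\<Sum>b\<in>Basis. K b)" if u: "u \<in> cball x r" for u
  proof (rule onorm_le)
    fix v
    have "norm (?D G (at u) v) = norm (\<Sum>b\<in>Basis. (v \<bullet> b) *\<^sub>R ?D G (at u) b)"
      using linear_basis_expansion[OF has_derivative_linear[OF der[OF u]], of v] by simp
    also have "\<dots> \<le> (\<Sum>b\<in>Basis. norm ((v \<bullet> b) *\<^sub>R ?D G (at u) b))"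
      by (rule norm_sum)
    also have "\<dots> \<le> (\<Sum>b\<in>Basis. norm v * K b)"
      using K[OF u] by (intro sum_mono) (auto intro!: mult_mono simp: Basis_le_norm)
    finally show "norm (?D G (at u) v) \<le> (\<Sum>b\<in>Basis. K b) * norm v"
      by (simp add: sum_distrib_left mult.commute)
  qed
  have "0 \<le> onorm (?D G (at x))"
    using der[of x] r by (intro onorm_pos_le has_derivative_bounded_linear) auto
  also have "\<dots> \<le> (\<Sum>b\<in>Basis. K b)" using on[of x] r by simp
  finally have "0 \<le> (\<Sum>b\<in>Basis. K b)" .
  moreover have "norm (G u - G v) \<le> (\<Sum>b\<in>Basis. K b) * norm (u - v)"
    if "u \<in> cball x r" "v \<in> cball x r" for u v
    by (rule differentiable_bound[OF convex_cball has_derivative_at_withinI[OF der] on that(1,2)])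
  ultimately show thesis using that[OF r(1) _ r(2)] by blast
qed

lemma norm_le_from_zero:
  fixes g :: "real \<Rightarrow> 'a::real_normed_vector"
  assumes "\<And>s. s \<in> {-e..e} \<Longrightarrow> (g has_vector_derivative g' s) (at s within {-e..e})"
    and "\<And>s. s \<in> {-e..e} \<Longrightarrow> norm (g' s) \<le> B" and "g 0 = 0" "t \<in> {-e..e}"
  shows "norm (g t) \<le> B * e"
proof -
  have z: "0 \<in> {-e..e}" using assms(4) by auto
  have "norm (g t - g 0) \<le> B * norm (t - 0)"
  proof (rule differentiable_bound[OF _ _ _ assms(4) z])
    show "(g has_derivative (\<lambda>r. r *\<^sub>R g' s)) (at s within {-e..e})" if "s \<in> {-e..e}" for s
      using assms(1)[OF that] by (simp add: has_vector_derivative_def)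
    show "onorm (\<lambda>r. r *\<^sub>R g' s) \<le> B" if "s \<in> {-e..e}" for s
      using assms(2)[OF that] by (simp add: onorm_scaleR_left_lemma onorm_scaleR_left onorm_id)
  qed simp
  also have "\<dots> \<le> B * e"
    using order_trans[OF norm_ge_zero assms(2)[OF z]] assms(4)
    by (intro mult_left_mono) (auto simp: abs_le_iff)
  finally show ?thesis using assms(3) by simp
qed

text \<open>
  The length \<open>e\<close> of the existence interval is the same for all initial values in \<open>cball x0 r\<close>. This
  uniformity makes the remainder of the expansion of the exponential map uniform in the direction.
  The solution is a fixed point of the Picard operator on bounded continuous functions on all of
  \<open>\<real>\<close>: precomposing the field with the nearest-point projection \<open>P\<close> onto the ball makes it globally
  Lipschitz, and freezing time outside \<open>[-e, e]\<close> keeps the integrals bounded.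
\<close>

lemma picard_lindelof_autonomous:
  fixes G :: "'a::euclidean_space \<Rightarrow> 'a"
  assumes "r > 0" "L \<ge> 0"
    and lip: "\<And>u v. u \<in> cball x0 (2*r) \<Longrightarrow> v \<in> cball x0 (2*r) \<Longrightarrow> norm (G u - G v) \<le> L * norm (u - v)"
  shows "\<exists>e>0. \<forall>a\<in>cball x0 r. \<exists>X. X 0 = a \<and>
    (\<forall>t\<in>{-e<..<e}. X t \<in> cball x0 (2*r) \<and> (X has_vector_derivative G (X t)) (at t))"
proof -
  let ?K = "cball x0 (2*r)"
  define P where "P = closest_point ?K"
  have PK: "P u \<in> ?K" for u
    unfolding P_def using assms(1) by (intro closest_point_in_set) auto
  have Pid: "P u = u" if "u \<in> ?K" for u
    unfolding P_def using that by (rule closest_point_self)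
  have Plip: "norm (P u - P v) \<le> norm (u - v)" for u v
    unfolding P_def dist_norm[symmetric] using assms(1) by (intro closest_point_lipschitz) auto
  define H where "H u = G (P u)" for u
  have Hlip: "norm (H u - H v) \<le> L * norm (u - v)" for u v
    using order_trans[OF lip[OF PK PK] mult_left_mono[OF Plip \<open>L \<ge> 0\<close>]] by (simp add: H_def)
  have Hcont: "continuous_on UNIV H"
  proof (rule lipschitz_on_continuous_on)
    show "L-lipschitz_on UNIV H"
      using Hlip \<open>L \<ge> 0\<close> by (intro lipschitz_onI) (auto simp: dist_norm)
  qed
  define B where "B = norm (G x0) + L * (2*r)"
  have B0: "B \<ge> 0" unfolding B_def using assms(1,2) by simp
  have HB: "norm (H u) \<le> B" for u
  proof -
    have "norm (H u) \<le> norm (G x0) + norm (H u - G x0)"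
      using norm_triangle_sub by blast
    also have "norm (H u - G x0) \<le> L * norm (P u - x0)"
      unfolding H_def using lip[OF PK] assms(1) by simp
    also have "\<dots> \<le> L * (2*r)"
      using PK[of u] \<open>L \<ge> 0\<close> by (intro mult_left_mono) (auto simp: dist_norm norm_minus_commute)
    finally show ?thesis by (simp add: B_def)
  qed
  define e where "e = min (r / (B + 1)) (1 / (2 * (L + 1)))"
  have e: "e > 0" using assms(1,2) B0 by (simp add: e_def)
  have Be: "B * e \<le> r"
  proof -
    have "B * e \<le> (B + 1) * (r / (B + 1))"
      using B0 e by (intro mult_mono) (auto simp: e_def)
    then show ?thesis using B0 by simp
  qed
  have Le: "L * e \<le> 1/2"
  proof -
    have "L * e \<le> (L + 1) * (1 / (2 * (L + 1)))"
      using assms(2) e by (intro mult_mono) (auto simp: e_def)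
    also have "\<dots> = 1/2" using assms(2) by (simp add: field_simps)
    finally show ?thesis .
  qed
  let ?I = "{-e..e}"
  \<comment> \<open>The integral from 0 to \<open>t\<close>, for \<open>t\<close> of either sign.\<close>
  define J where "J = (\<lambda>(X :: real \<Rightarrow>\<^sub>C 'a) t. integral {-e..t} (\<lambda>s. H (X s)) - integral {-e..0} (\<lambda>s. H (X s)))"
  have HXcont: "continuous_on A (\<lambda>s. H (apply_bcontfun X s))" for X A
    by (rule continuous_on_compose2[OF Hcont]) auto
  have Jder: "(J X has_vector_derivative H (X t)) (at t within ?I)" if "t \<in> ?I" for X t
    unfolding J_def
    using has_vector_derivative_diff[OF integral_has_vector_derivative[OF HXcont that] has_vector_derivative_const]
    by simp
  have J0: "J X 0 = 0" for X by (simp add: J_def)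
  have JB: "norm (J X t) \<le> B * e" if "t \<in> ?I" for X t
    by (rule norm_le_from_zero[OF Jder HB J0 that])
  have Jlip: "norm (J X t - J Y t) \<le> 1/2 * dist X Y" if "t \<in> ?I" for X Y t
  proof -
    have "norm (J X t - J Y t) \<le> (L * dist X Y) * e"
    proof (rule norm_le_from_zero[OF has_vector_derivative_diff[OF Jder Jder] _ _ that])
      show "norm (H (X s) - H (Y s)) \<le> L * dist X Y" for s
        using order_trans[OF Hlip mult_left_mono[OF dist_bounded[of X s Y, unfolded dist_norm] \<open>L \<ge> 0\<close>]]
        by (simp add: dist_norm)
    qed (simp_all add: J0)
    also have "\<dots> = (L * e) * dist X Y" by simp
    also have "\<dots> \<le> 1/2 * dist X Y" using Le by (intro mult_right_mono) auto
    finally show ?thesis .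
  qed
  define clip where "clip t = max (-e) (min e t)" for t
  have clip: "clip t \<in> ?I" for t using e by (auto simp: clip_def)
  have clip_id: "clip t = t" if "t \<in> ?I" for t using that by (auto simp: clip_def)
  show ?thesis
  proof (intro exI[of _ e] conjI ballI e)
    fix a assume a: "a \<in> cball x0 r"
    define T where "T X = Bcontfun (\<lambda>t. a + J X (clip t))" for X
    have T_app: "T X t = a + J X (clip t)" for X t
    proof -
      have "continuous_on ?I (J X)"
        using Jder by (intro continuous_on_vector_derivative)
      moreover have "continuous_on UNIV clip" unfolding clip_def by (intro continuous_intros)
      ultimately have "continuous_on UNIV (\<lambda>t. J X (clip t))"
        using clip by (intro continuous_on_compose2[of ?I "J X" UNIV clip]) auto
      then have "(\<lambda>t. a + J X (clip t)) \<in> bcontfun"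
        using JB[OF clip] norm_triangle_le[of a _ "norm a + B * e"]
        by (intro bcontfun_normI[where b="norm a + B * e"] continuous_intros) auto
      then show ?thesis by (simp add: T_def Bcontfun_inverse)
    qed
    have "\<exists>!X. T X = X"
    proof (rule banach_fix_type[of "1/2"], goal_cases)
      case 3
      show ?case
      proof (intro allI dist_bound)
        show "dist (T X s) (T Y s) \<le> 1/2 * dist X Y" for X Y s
          using Jlip[OF clip[of s], of X Y] by (simp add: T_app dist_norm)
      qed
    qed auto
    then obtain X where X: "T X = X" by blast
    have Xeq: "X t = a + J X (clip t)" for t using T_app[of X t] by (simp add: X)
    have XK: "X t \<in> ?K" for t
    proof -
      have "dist x0 (X t) \<le> dist x0 a + dist a (X t)" by (rule dist_triangle)
      also have "dist a (X t) \<le> r"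
        using order_trans[OF JB[OF clip[of t]] Be, of X] by (simp add: Xeq[of t] dist_norm)
      finally show ?thesis using a by simp
    qed
    show "\<exists>X. X 0 = a \<and> (\<forall>t\<in>{-e<..<e}. X t \<in> ?K \<and> (X has_vector_derivative G (X t)) (at t))"
    proof (intro exI[of _ "apply_bcontfun X"] conjI ballI XK)
      show "X 0 = a" using Xeq[of 0] e by (simp add: clip_id J0)
      fix t assume t: "t \<in> {-e<..<e}"
      have "(J X has_vector_derivative H (X t)) (at t)"
        using Jder[of t X] t at_within_Icc_at[of "-e" t e] by auto
      then have "((\<lambda>t. a + J X t) has_vector_derivative H (X t)) (at t)"
        by (auto intro!: derivative_eq_intros)
      then have "(X has_vector_derivative H (X t)) (at t)"
        by (rule has_vector_derivative_transform_within_open[of _ _ t "{-e<..<e}"])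
          (use t in \<open>auto simp: Xeq[of] clip_id\<close>)
      then show "(X has_vector_derivative G (X t)) (at t)"
        using Pid[OF XK] by (simp add: H_def)
    qed
  qed
qed

text \<open>
  On an interval of radius \<open>e\<close> with \<open>L e < 1\<close> the maximum of the distance of two solutions is at most
  \<open>L e\<close> times itself, hence zero.
\<close>

lemma ode_local_uniqueness:
  fixes G :: "'a::euclidean_space \<Rightarrow> 'a"
  assumes S: "open S" "Ck_on (Suc 0) S G" and J: "open J" "t0 \<in> J"
    and X: "\<And>t. t \<in> J \<Longrightarrow> X t \<in> S \<and> (X has_vector_derivative G (X t)) (at t)"
    and Y: "\<And>t. t \<in> J \<Longrightarrow> Y t \<in> S \<and> (Y has_vector_derivative G (Y t)) (at t)"
    and eq: "X t0 = Y t0"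
  obtains d where "d > 0" "ball t0 d \<subseteq> J" "\<And>t. t \<in> ball t0 d \<Longrightarrow> X t = Y t"
proof -
  obtain r L where r: "r > 0" "L \<ge> 0" and
    lip: "\<And>u v. u \<in> cball (X t0) r \<Longrightarrow> v \<in> cball (X t0) r \<Longrightarrow> norm (G u - G v) \<le> L * norm (u - v)"
    by (rule C1_locally_lipschitz[OF S conjunct1[OF X[OF J(2)]]]) (rule that)
  have near: "\<exists>d>0. \<forall>t. dist t t0 < d \<longrightarrow> dist (Z t) (Z t0) < r"
    if "(Z has_vector_derivative z) (at t0)" for Z :: "real \<Rightarrow> 'a" and z
    using has_vector_derivative_continuous[OF that] r(1) unfolding continuous_at_eps_delta by auto
  obtain d1 where d1: "d1 > 0" "\<And>t. dist t t0 < d1 \<Longrightarrow> dist (X t) (X t0) < r"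
    using near[OF conjunct2[OF X[OF J(2)]]] by auto
  obtain d2 where d2: "d2 > 0" "\<And>t. dist t t0 < d2 \<Longrightarrow> dist (Y t) (Y t0) < r"
    using near[OF conjunct2[OF Y[OF J(2)]]] by auto
  obtain d3 where d3: "d3 > 0" "ball t0 d3 \<subseteq> J" using J openE by blast
  define e where "e = min (min d1 d2) (min d3 (1 / (L + 1))) / 2"
  have e: "e > 0" using d1 d2 d3 r by (simp add: e_def)
  have "2 * e \<le> 1 / (L + 1)" by (simp add: e_def)
  then have "2 * e * (L + 1) \<le> 1" using r by (simp add: pos_le_divide_eq)
  then have "e + L * e \<le> 1/2" by (simp add: algebra_simps)
  then have Le: "L * e < 1" using e by linarith
  let ?I = "{t0 - e..t0 + e}"
  have I: "dist t t0 < d1" "dist t t0 < d2" "t \<in> J" if "t \<in> ?I" for t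
  proof -
    have "dist t t0 \<le> e" using that by (auto simp: dist_real_def abs_le_iff)
    moreover have "e < d1" "e < d2" "e < d3"
      using d1(1) d2(1) d3(1) by (auto simp: e_def min_def)
    ultimately show "dist t t0 < d1" by simp
    show "dist t t0 < d2" "t \<in> J" using \<open>dist t t0 \<le> e\<close> \<open>e < d2\<close> \<open>e < d3\<close> d3(2)
      by (auto simp: dist_commute)
  qed
  define g where "g t = X t - Y t" for t
  have gd: "(g has_vector_derivative G (X t) - G (Y t)) (at t)" if "t \<in> J" for t
    unfolding g_def using X[OF that] Y[OF that] by (intro has_vector_derivative_diff) auto
  have "continuous_on ?I (\<lambda>t. norm (g t))"
    by (intro continuous_on_norm continuous_at_imp_continuous_on ballI
        has_vector_derivative_continuous[OF gd] I(3))
  then obtain s where s: "s \<in> ?I" "\<And>t. t \<in> ?I \<Longrightarrow> norm (g t) \<le> norm (g s)"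
    using continuous_attains_sup[of ?I "\<lambda>t. norm (g t)"] e by fastforce
  have t0: "t0 \<in> ?I" using e by auto
  have "norm (g s - g t0) \<le> (L * norm (g s)) * norm (s - t0)"
  proof (rule differentiable_bound[OF _ _ _ s(1) t0])
    fix t assume t: "t \<in> ?I"
    show "(g has_derivative (\<lambda>r. r *\<^sub>R (G (X t) - G (Y t)))) (at t within ?I)"
      using gd[OF I(3)[OF t]] by (simp add: has_vector_derivative_def has_derivative_at_withinI)
    have "X t \<in> cball (X t0) r" "Y t \<in> cball (X t0) r"
      using d1(2)[OF I(1)[OF t]] d2(2)[OF I(2)[OF t]] by (auto simp: eq dist_commute less_imp_le)
    then have "norm (G (X t) - G (Y t)) \<le> L * norm (g t)"
      unfolding g_def by (rule lip)
    also have "\<dots> \<le> L * norm (g s)" using s(2)[OF t] r by (intro mult_left_mono)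
    finally show "onorm (\<lambda>r. r *\<^sub>R (G (X t) - G (Y t))) \<le> L * norm (g s)"
      by (simp add: onorm_scaleR_left onorm_id)
  qed simp
  then have "norm (g s) \<le> (L * norm (g s)) * norm (s - t0)" by (simp add: g_def eq)
  also have "\<dots> \<le> (L * norm (g s)) * e"
    using s(1) r by (intro mult_left_mono) (auto simp: abs_le_iff)
  finally have "norm (g s) * (1 - L * e) \<le> 0" by (simp add: algebra_simps)
  then have "norm (g s) = 0" using Le by (simp add: mult_le_0_iff)
  then have "X t = Y t" if "t \<in> ball t0 e" for t
    using s(2)[of t] that by (auto simp: g_def dist_real_def abs_less_iff)
  moreover have "ball t0 e \<subseteq> J"
  proof
    show "t \<in> J" if "t \<in> ball t0 e" for t
      by (rule I(3)) (use that in \<open>auto simp: dist_real_def abs_less_iff\<close>)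
  qed
  ultimately show thesis using that[OF e] by blast
qed

lemma ode_solution_smooth:
  fixes G :: "'a::euclidean_space \<Rightarrow> 'a" and X :: "real \<Rightarrow> 'a"
  assumes "smooth_on S G" "open J"
    and X: "\<And>t. t \<in> J \<Longrightarrow> X t \<in> S \<and> (X has_vector_derivative G (X t)) (at t)"
  shows "smooth_on J X"
proof -
  have "Ck_on n J X" for n
  proof (induction n)
    case 0
    show ?case
      using X has_vector_derivative_continuous by (simp, blast intro: continuous_at_imp_continuous_on)
  next
    case (Suc n)
    show ?case
    proof (rule Ck_on_SucI[OF \<open>open J\<close>])
      show "(X has_derivative (\<lambda>r. r *\<^sub>R G (X t))) (at t)" if "t \<in> J" for t
        using X[OF that] by (simp add: has_vector_derivative_def)
      show "Ck_on n J (\<lambda>t. r *\<^sub>R G (X t))" for r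
        using X smooth_onD[OF assms(1)] \<open>open J\<close> Suc
        by (intro Ck_on_scaleR Ck_on_compose[OF _ Suc]) auto
    qed
  qed
  then show ?thesis by (simp add: smooth_on_def)
qed

text \<open>
  The mean value form of the remainder holds only for real functions, at a different intermediate
  point for every coordinate; hence the factor \<open>DIM('b)\<close>.
\<close>

lemma taylor_remainder_bound:
  fixes y :: "nat \<Rightarrow> real \<Rightarrow> 'b::euclidean_space" and C :: real
  assumes "n > 0" "\<And>m t. t \<in> {0..1} \<Longrightarrow> (y m has_vector_derivative y (Suc m) t) (at t)"
    and "\<And>t. t \<in> {0..1} \<Longrightarrow> norm (y n t) \<le> (C::real)"
  shows "norm (y 0 1 - (\<Sum>m<n. (1 / fact m) *\<^sub>R y m 0)) \<le> DIM('b) * C"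
proof -
  let ?R = "y 0 1 - (\<Sum>m<n. (1 / fact m) *\<^sub>R y m 0)"
  have "\<bar>?R \<bullet> b\<bar> \<le> C" if b: "b \<in> Basis" for b
  proof -
    have "\<exists>t>0. t < 1 \<and> y 0 1 \<bullet> b = (\<Sum>m<n. (y m 0 \<bullet> b / fact m) * 1 ^ m) + (y n t \<bullet> b / fact n) * 1 ^ n"
    proof (rule Maclaurin[where diff="\<lambda>m t. y m t \<bullet> b"])
      show "\<forall>m t. m < n \<and> 0 \<le> t \<and> t \<le> 1 \<longrightarrow>
          ((\<lambda>t. y m t \<bullet> b) has_real_derivative y (Suc m) t \<bullet> b) (at t)"
        using bounded_linear.has_vector_derivative[OF bounded_linear_inner_left assms(2)]
        by (simp add: has_real_derivative_iff_has_vector_derivative)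
    qed (use assms in auto)
    then obtain t where t: "0 < t" "t < 1"
      and *: "y 0 1 \<bullet> b = (\<Sum>m<n. y m 0 \<bullet> b / fact m) + y n t \<bullet> b / fact n" by auto
    have "\<bar>?R \<bullet> b\<bar> = \<bar>y n t \<bullet> b\<bar> / fact n"
      by (simp add: inner_diff_left inner_sum_left *)
    also have "\<dots> \<le> \<bar>y n t \<bullet> b\<bar> / 1"
      by (intro divide_left_mono) (auto simp: fact_ge_1)
    also have "\<dots> \<le> C" using Basis_le_norm[OF b, of "y n t"] assms(3)[of t] t by simp
    finally show ?thesis .
  qed
  then have "(\<Sum>b\<in>Basis. \<bar>?R \<bullet> b\<bar>) \<le> (\<Sum>b\<in>(Basis::'b set). C)" by (intro sum_mono) auto
  then show ?thesis using norm_le_l1[of ?R] by simp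
qed

text \<open>
  The Lie derivative of a function along the vector field \<open>G\<close>. Iterating it gives all time
  derivatives of \<open>h (X t)\<close> along a solution \<open>X\<close> as smooth functions of the position \<open>X t\<close>, so they
  are bounded on compact sets independently of the solution.
\<close>

definition lie :: "('a::real_normed_vector \<Rightarrow> 'a) \<Rightarrow> ('a \<Rightarrow> 'b::real_normed_vector) \<Rightarrow> 'a \<Rightarrow> 'b"
  where "lie G h u = frechet_derivative h (at u) (G u)"

lemma smooth_lie:
  fixes G :: "'a::euclidean_space \<Rightarrow> 'a"
  assumes "open S" "smooth_on S G" "smooth_on S h"
  shows "smooth_on S (lie G h)"
  unfolding lie_def[abs_def]
  by (rule smooth_on_linear_family[OF assms(1) smooth_on_derivative[OF assms(3)]
        linear_frechet_derivative[OF smooth_on_differentiable[OF assms(3)]] assms(2)])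

lemma smooth_lie_power:
  fixes G :: "'a::euclidean_space \<Rightarrow> 'a"
  assumes "open S" "smooth_on S G" "smooth_on S h"
  shows "smooth_on S ((lie G ^^ m) h)"
  by (induction m) (simp_all add: assms smooth_lie)

lemma lie_along_solution:
  assumes "smooth_on S h" "X t \<in> S" "(X has_vector_derivative G (X t)) (at t)"
  shows "((\<lambda>t. h (X t)) has_vector_derivative lie G h (X t)) (at t)"
  using has_derivative_compose[OF assms(3)[unfolded has_vector_derivative_def]
      smooth_on_has_derivative[OF assms(1,2)]]
  by (simp add: has_vector_derivative_def lie_def
      linear_scale[OF linear_frechet_derivative[OF smooth_on_differentiable[OF assms(1,2)]]])

lemma vector_derivative_eq_on_open:
  assumes "open J" "t \<in> J" "\<And>s. s \<in> J \<Longrightarrow> g s = h s"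
    and "(g has_vector_derivative a) (at t)" "(h has_vector_derivative b) (at t)"
  shows "a = b"
  using has_vector_derivative_transform_within_open[OF assms(4,1,2,3)] assms(5)
  by (rule vector_derivative_unique_at)

lemma has_vector_derivative_rescale:
  assumes "(g has_vector_derivative g') (at (s * t))"
  shows "((\<lambda>t. g (s * t)) has_vector_derivative s *\<^sub>R g') (at t)"
proof -
  have "((\<lambda>t. s * t) has_vector_derivative s) (at t)"
    by (auto intro!: derivative_eq_intros simp: has_real_derivative_iff_has_vector_derivative[symmetric])
  from vector_diff_chain_at[OF this assms] show ?thesis by (simp add: o_def)
qed

section \<open>Immersions of coordinate domains\<close>

text \<open>
  The local form of an immersed submanifold: in a chart the immersion becomes a map \<open>f\<close> on an open
  set \<open>S\<close> of coordinates.
\<close>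

locale parametrized_immersion =
  fixes S :: "(real^'k::finite) set" and f :: "real^'k \<Rightarrow> real^'n::finite"
  assumes open_S: "open S" and smooth_f: "smooth_on S f"
    and inj_f: "\<And>u. u \<in> S \<Longrightarrow> inj (frechet_derivative f (at u))"
begin

definition D :: "real^'k \<Rightarrow> real^'k \<Rightarrow> real^'n"
  where "D u w = frechet_derivative f (at u) w"

text \<open>
  The first fundamental form, or metric tensor, in coordinates.
\<close>

definition gram :: "real^'k \<Rightarrow> real^'k^'k"
  where "gram u = (\<chi> i j. D u (axis i 1) \<bullet> D u (axis j 1))"

text \<open>
  The left inverse \<open>G\<^sup>-\<^sup>1 D\<^sup>T\<close>, with \<open>G = D\<^sup>T D\<close>, of the differential \<open>D u\<close>, which kills normal vectors. Writing the
  inverse of the Gram matrix with Cramer's rule makes its smoothness in \<open>u\<close> evident.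
\<close>

definition pinv :: "real^'k \<Rightarrow> real^'n \<Rightarrow> real^'k"
  where "pinv u x = (\<chi> k. det (\<chi> i j. if j = k then (\<chi> i. D u (axis i 1) \<bullet> x) $ i else gram u $ i $ j)
    / det (gram u))"

text \<open>
  The orthogonal projection onto the tangent space \<open>range (D u)\<close>.
\<close>

definition tproj :: "real^'k \<Rightarrow> real^'n \<Rightarrow> real^'n"
  where "tproj u x = D u (pinv u x)"

definition dtproj :: "real^'k \<Rightarrow> real^'k \<Rightarrow> real^'n \<Rightarrow> real^'n"
  where "dtproj u w x = frechet_derivative (\<lambda>u. tproj u x) (at u) w"

text \<open>
  The second fundamental form, extended to all vectors. That the derivative of the tangent
  projection gives it is seen by differentiating \<open>tproj u (Y u) = Y u\<close> for a tangent field \<open>Y\<close>: the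
  result says that the normal part of \<open>D\<^sub>x Y\<close> is \<open>dtproj u (pinv u x) (Y u)\<close>. This expression
  depends only on the values of \<open>x\<close> and \<open>Y\<close> at the point.
\<close>

definition sff :: "real^'k \<Rightarrow> real^'n \<Rightarrow> real^'n \<Rightarrow> real^'n"
  where "sff u x y = dtproj u (pinv u x) y"

definition dsff :: "real^'k \<Rightarrow> real^'k \<Rightarrow> real^'n \<Rightarrow> real^'n \<Rightarrow> real^'n"
  where "dsff u w x y = frechet_derivative (\<lambda>u. sff u x y) (at u) w"

definition D2 :: "real^'k \<Rightarrow> real^'k \<Rightarrow> real^'k \<Rightarrow> real^'n"
  where "D2 u z w = frechet_derivative (\<lambda>u. D u z) (at u) w"

lemma D_has_derivative: "u \<in> S \<Longrightarrow> (f has_derivative D u) (at u)"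
  using smooth_on_has_derivative[OF smooth_f] by (simp add: D_def[abs_def])

lemma linear_D: "u \<in> S \<Longrightarrow> linear (D u)"
  using D_has_derivative has_derivative_linear by blast

lemma inj_D: "u \<in> S \<Longrightarrow> D u v = D u w \<Longrightarrow> v = w"
  using inj_f unfolding D_def by (meson injD)

lemma smooth_D: "smooth_on S (\<lambda>u. D u w)"
  unfolding D_def by (rule smooth_on_derivative[OF smooth_f])

lemma D_axis_expansion:
  assumes "u \<in> S"
  shows "D u w = (\<Sum>i\<in>UNIV. w $ i *\<^sub>R D u (axis i 1))"
proof -
  have "D u w = D u (\<Sum>i\<in>UNIV. w $ i *\<^sub>R axis i 1)"
    using basis_expansion[of w] by (simp add: scalar_mult_eq_scaleR)
  then show ?thesis
    by (simp add: linear_sum[OF linear_D[OF assms]] linear_scale[OF linear_D[OF assms]])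
qed

lemma gram_mult:
  assumes "u \<in> S"
  shows "gram u *v w = (\<chi> i. D u (axis i 1) \<bullet> D u w)"
  by (subst D_axis_expansion[OF assms, of w])
    (simp add: vec_eq_iff matrix_vector_mult_def gram_def inner_sum_right mult.commute)

lemma det_gram:
  assumes "u \<in> S"
  shows "det (gram u) \<noteq> 0"
proof -
  have "w = 0" if "gram u *v w = 0" for w
  proof -
    have "D u w \<bullet> D u w = (\<Sum>i\<in>UNIV. w $ i * (D u (axis i 1) \<bullet> D u w))"
      by (subst (1) D_axis_expansion[OF assms, of w]) (simp add: inner_sum_left)
    also have "\<dots> = 0"
      using that by (simp add: gram_mult[OF assms] vec_eq_iff)
    finally have "D u w = D u 0" using linear_0[OF linear_D[OF assms]] by simp
    then show "w = 0" by (rule inj_D[OF assms])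
  qed
  then show ?thesis
    by (metis invertible_det_nz invertible_left_inverse matrix_left_invertible_ker)
qed

lemma pinv_iff:
  assumes "u \<in> S"
  shows "pinv u x = w \<longleftrightarrow> (\<forall>z. D u z \<bullet> (x - D u w) = 0)"
proof -
  have "pinv u x = w \<longleftrightarrow> gram u *v w = (\<chi> i. D u (axis i 1) \<bullet> x)"
    unfolding pinv_def cramer[OF det_gram[OF assms]] by auto
  also have "\<dots> \<longleftrightarrow> (\<forall>i. D u (axis i 1) \<bullet> (x - D u w) = 0)"
    by (auto simp: gram_mult[OF assms] vec_eq_iff inner_diff_right)
  also have "\<dots> \<longleftrightarrow> (\<forall>z. D u z \<bullet> (x - D u w) = 0)"
  proof (intro iffI allI)
    fix z assume *: "\<forall>i. D u (axis i 1) \<bullet> (x - D u w) = 0"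
    show "D u z \<bullet> (x - D u w) = 0"
      by (subst D_axis_expansion[OF assms]) (simp add: inner_sum_left *)
  qed auto
  finally show ?thesis .
qed

lemma tproj_orth: "u \<in> S \<Longrightarrow> D u z \<bullet> (x - tproj u x) = 0"
  using pinv_iff[of u x "pinv u x"] by (simp add: tproj_def)

lemma pinv_D [simp]: "u \<in> S \<Longrightarrow> pinv u (D u w) = w"
  by (simp add: pinv_iff)

lemma tproj_D [simp]: "u \<in> S \<Longrightarrow> tproj u (D u w) = D u w"
  by (simp add: tproj_def)

lemma pinv_tproj [simp]: "u \<in> S \<Longrightarrow> pinv u (tproj u x) = pinv u x"
  by (simp add: tproj_def)

lemma tproj_tproj [simp]: "u \<in> S \<Longrightarrow> tproj u (tproj u x) = tproj u x"
  by (simp add: tproj_def)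

lemma linear_pinv: assumes "u \<in> S" shows "linear (pinv u)"
proof (rule linearI)
  note L = linear_D[OF assms]
  have o: "D u z \<bullet> x = D u z \<bullet> D u (pinv u x)" for z x
    using tproj_orth[OF assms, of z x] by (simp add: tproj_def inner_diff_right)
  show "pinv u (x + y) = pinv u x + pinv u y" for x y
    unfolding pinv_iff[OF assms] by (auto simp: linear_add[OF L] inner_diff_right inner_add_right o[symmetric])
  show "pinv u (r *\<^sub>R x) = r *\<^sub>R pinv u x" for r x
    unfolding pinv_iff[OF assms] by (auto simp: linear_scale[OF L] inner_diff_right o[symmetric])
qed

lemma linear_tproj: "u \<in> S \<Longrightarrow> linear (tproj u)"
  using linear_compose[OF linear_pinv linear_D, of u] by (simp add: o_def tproj_def[abs_def])

lemma pinv_eq_0_iff: "u \<in> S \<Longrightarrow> pinv u x = 0 \<longleftrightarrow> tproj u x = 0"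
  unfolding tproj_def using inj_D linear_0[OF linear_D] by metis

lemma tproj_symmetric: assumes "u \<in> S" shows "tproj u x \<bullet> y = x \<bullet> tproj u y"
proof -
  have "tproj u x \<bullet> y = tproj u x \<bullet> tproj u y" "tproj u y \<bullet> x = tproj u y \<bullet> tproj u x"
    using tproj_orth[OF assms, of "pinv u x" y] tproj_orth[OF assms, of "pinv u y" x]
    by (simp_all add: tproj_def inner_diff_right)
  then show ?thesis by (simp add: inner_commute)
qed

lemma smooth_pinv: "smooth_on S (\<lambda>u. pinv u x)"
  unfolding smooth_on_def
proof
  fix n
  have g: "Ck_on n S (\<lambda>u. D u v \<bullet> D u w)" "Ck_on n S (\<lambda>u. D u v \<bullet> x)" for v w
    using smooth_onD[OF smooth_D] by (auto intro!: Ck_on_inner open_S)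
  have e: "Ck_on n S (\<lambda>u. if j = k then D u (axis i 1) \<bullet> x else gram u $ i $ j)" for i j k
    using g by (cases "j = k") (simp_all add: gram_def)
  have "Ck_on n S (\<lambda>u. det (gram u))"
    using g by (intro Ck_on_det open_S) (simp add: gram_def)
  moreover have "Ck_on n S (\<lambda>u. det (\<chi> i j. if j = k then (\<chi> i. D u (axis i 1) \<bullet> x) $ i else gram u $ i $ j))" for k
    by (rule Ck_on_det[OF open_S]) (unfold vec_lambda_beta, rule e)
  ultimately show "Ck_on n S (\<lambda>u. pinv u x)"
    unfolding pinv_def using det_gram by (intro Ck_on_vec Ck_on_divide open_S) auto
qed

lemma smooth_tproj: "smooth_on S (\<lambda>u. tproj u x)"
  unfolding tproj_def by (rule smooth_on_linear_family[OF open_S smooth_D linear_D smooth_pinv])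

lemma smooth_dtproj: "smooth_on S (\<lambda>u. dtproj u w x)"
  unfolding dtproj_def by (rule smooth_on_derivative[OF smooth_tproj])

lemma tproj_has_derivative: "u \<in> S \<Longrightarrow> ((\<lambda>u. tproj u x) has_derivative (\<lambda>w. dtproj u w x)) (at u)"
  using smooth_on_has_derivative[OF smooth_tproj] by (simp add: dtproj_def)

lemma linear_dtproj1: "u \<in> S \<Longrightarrow> linear (\<lambda>w. dtproj u w x)"
  by (rule has_derivative_linear[OF tproj_has_derivative])

lemma linear_dtproj2: "u \<in> S \<Longrightarrow> linear (dtproj u w)"
  unfolding dtproj_def[abs_def]
  by (rule frechet_linear_family_linear[OF open_S _ smooth_on_differentiable[OF smooth_tproj] linear_tproj])

lemma linear_sff1: "u \<in> S \<Longrightarrow> linear (\<lambda>x. sff u x y)"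
  using linear_compose[OF linear_pinv linear_dtproj1, of u] by (simp add: sff_def o_def)

lemma linear_sff2: "u \<in> S \<Longrightarrow> linear (sff u x)"
  using linear_dtproj2 by (simp add: sff_def[abs_def])

lemma smooth_sff: "smooth_on S (\<lambda>u. sff u x y)"
  unfolding sff_def
  by (rule smooth_on_linear_family[OF open_S, where Q="\<lambda>u w. dtproj u w y", OF smooth_dtproj linear_dtproj1 smooth_pinv])

text \<open>
  The decomposition of the derivative of a tangent field into second fundamental form and tangent
  connection. It is the product rule for \<open>tproj v (y v) = y v\<close>.
\<close>

lemma tangent_field_derivative:
  assumes "open T" "T \<subseteq> S" "u \<in> T" "(y has_derivative y') (at u)" "\<And>v. v \<in> T \<Longrightarrow> tproj v (y v) = y v"
  shows "y' w = dtproj u w (y u) + tproj u (y' w)"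
proof -
  have "((\<lambda>v. tproj v (y v)) has_derivative
      (\<lambda>h. frechet_derivative (\<lambda>v. tproj v (y u)) (at u) h + tproj u (y' h))) (at u)"
    using assms by (intro has_derivative_linear_family[OF open_S, where c="\<lambda>v. v" and Q=tproj]
        smooth_on_differentiable[OF smooth_tproj] linear_tproj has_derivative_ident) auto
  then have "(y has_derivative (\<lambda>h. dtproj u h (y u) + tproj u (y' h))) (at u)"
    unfolding dtproj_def
    by (rule has_derivative_transform_within_open[OF _ assms(1,3)]) (use assms in auto)
  from has_derivative_unique[OF assms(4) this] show ?thesis by metis
qed

text \<open>
  Differentiating \<open>tproj u (tproj u x) = tproj u x\<close> shows that the derivative of the projection
  exchanges tangent and normal vectors.
\<close>

lemma dtproj_tproj: "u \<in> S \<Longrightarrow> dtproj u w (tproj u x) + tproj u (dtproj u w x) = dtproj u w x"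
  using tangent_field_derivative[OF open_S subset_refl _ tproj_has_derivative] by simp

lemma tproj_dtproj_tangent: "u \<in> S \<Longrightarrow> tproj u x = x \<Longrightarrow> tproj u (dtproj u w x) = 0"
  using dtproj_tproj[of u w x] by simp

lemma tproj_dtproj_normal: "u \<in> S \<Longrightarrow> tproj u x = 0 \<Longrightarrow> tproj u (dtproj u w x) = dtproj u w x"
  using dtproj_tproj[of u w x] linear_0[OF linear_dtproj2] by simp

text \<open>
  For tangent \<open>x\<close> and normal \<open>y\<close> this is Weingarten's relation between the shape operator and the
  second fundamental form. It is inherited from the symmetry of the projection.
\<close>

lemma dtproj_symmetric: assumes "u \<in> S" shows "dtproj u w x \<bullet> y = x \<bullet> dtproj u w y"
proof -
  have 1: "((\<lambda>u. tproj u x \<bullet> y) has_derivative (\<lambda>w. dtproj u w x \<bullet> y)) (at u)"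
    by (rule bounded_linear.has_derivative[OF bounded_linear_inner_left tproj_has_derivative[OF assms]])
  have "((\<lambda>u. x \<bullet> tproj u y) has_derivative (\<lambda>w. x \<bullet> dtproj u w y)) (at u)"
    by (rule bounded_linear.has_derivative[OF bounded_linear_inner_right tproj_has_derivative[OF assms]])
  then have "((\<lambda>u. tproj u x \<bullet> y) has_derivative (\<lambda>w. x \<bullet> dtproj u w y)) (at u)"
    by (rule has_derivative_transform_within_open[OF _ open_S assms]) (simp add: tproj_symmetric)
  from has_derivative_unique[OF 1 this] show ?thesis by metis
qed

lemma D_field_has_derivative: "u \<in> S \<Longrightarrow> ((\<lambda>u. D u z) has_derivative D2 u z) (at u)"
  using smooth_on_has_derivative[OF smooth_D] by (simp add: D2_def[abs_def])

lemma D2_symmetric: "u \<in> S \<Longrightarrow> D2 u z w = D2 u w z"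
  unfolding D2_def D_def by (rule second_derivative_symmetric[OF open_S smooth_onD[OF smooth_f]])

text \<open>
  The vectors \<open>D u z\<close> for a constant \<open>z\<close> form a tangent field, a coordinate field. This gives the
  second fundamental form as the normal part of the second derivative of \<open>f\<close>, and so its
  symmetry.
\<close>

lemma D2_normal: "u \<in> S \<Longrightarrow> dtproj u w (D u z) = D2 u z w - tproj u (D2 u z w)"
  using tangent_field_derivative[OF open_S subset_refl _ D_field_has_derivative, of u z w] by (simp add: algebra_simps)

lemma linear_D2: "u \<in> S \<Longrightarrow> linear (D2 u z)"
  by (rule has_derivative_linear[OF D_field_has_derivative])

lemma sff_D: "u \<in> S \<Longrightarrow> sff u (D u z) y = dtproj u z y"
  by (simp add: sff_def)

lemma sff_symmetric:
  assumes "u \<in> S" "tproj u x = x" "tproj u y = y"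
  shows "sff u x y = sff u y x"
proof -
  obtain v w where "x = D u v" "y = D u w" using assms unfolding tproj_def by metis
  then show ?thesis using assms(1) by (simp add: sff_D D2_normal D2_symmetric[of u v w])
qed

lemma sff_normal_left: "u \<in> S \<Longrightarrow> tproj u x = 0 \<Longrightarrow> sff u x y = 0"
  using pinv_eq_0_iff[of u x] linear_0[OF linear_dtproj1, of u y] by (simp add: sff_def)

lemma sff_has_derivative:
  assumes "c s \<in> S" "(c has_derivative c') (at s)" "(x has_derivative x') (at s)"
    "(y has_derivative y') (at s)"
  shows "((\<lambda>s. sff (c s) (x s) (y s)) has_derivative
    (\<lambda>h. dsff (c s) (c' h) (x s) (y s) + sff (c s) (x' h) (y s) + sff (c s) (x s) (y' h))) (at s)"
  unfolding dsff_def
  by (rule has_derivative_bilinear_family[OF open_S assms(1) smooth_on_differentiable[OF smooth_sff]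
        linear_sff1 linear_sff2 assms(2-4)])

section \<open>Geodesics in coordinates\<close>

text \<open>
  The geodesic spray: the vector field of the geodesic equation written as a first-order system for
  position and velocity in coordinates. The term \<open>pinv u (D2 u v v)\<close> is the usual Christoffel term.
\<close>

definition spray :: "(real^'k) \<times> (real^'k) \<Rightarrow> (real^'k) \<times> (real^'k)"
  where "spray p = (snd p, - pinv (fst p) (D2 (fst p) (snd p) (snd p)))"

abbreviation TS :: "((real^'k) \<times> (real^'k)) set" where "TS \<equiv> S \<times> UNIV"

lemma open_TS: "open TS"
  using open_S by (simp add: open_Times)

lemma smooth_D2: "smooth_on S (\<lambda>u. D2 u z w)"
  unfolding D2_def by (rule smooth_on_derivative[OF smooth_D])

lemma linear_D2': "u \<in> S \<Longrightarrow> linear (\<lambda>z. D2 u z w)"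
  unfolding D2_def
  by (rule frechet_linear_family_linear[OF open_S _ smooth_on_differentiable[OF smooth_D] linear_D])

lemma smooth_fst: "smooth_on TS fst" and smooth_snd: "smooth_on TS snd"
  unfolding smooth_on_def
  using Ck_on_bounded_linear[OF open_TS bounded_linear_fst Ck_on_ident[OF open_TS]]
    Ck_on_bounded_linear[OF open_TS bounded_linear_snd Ck_on_ident[OF open_TS]] by auto

lemma smooth_spray: "smooth_on TS spray"
proof -
  have base: "smooth_on TS (\<lambda>p. g (fst p))" if "smooth_on S g" for g :: "real^'k \<Rightarrow> 'z::real_normed_vector"
    by (rule smooth_on_compose[OF open_TS smooth_fst that]) auto
  have "smooth_on TS (\<lambda>p. D2 (fst p) b (snd p))" for b
    by (rule smooth_on_linear_family[OF open_TS, where Q="\<lambda>p. D2 (fst p) b", OF base[OF smooth_D2] _ smooth_snd])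
      (auto intro: linear_D2)
  then have "smooth_on TS (\<lambda>p. D2 (fst p) (snd p) (snd p))"
    by (rule smooth_on_linear_family[OF open_TS, where Q="\<lambda>p b. D2 (fst p) b (snd p)", OF _ _ smooth_snd])
      (auto intro: linear_D2')
  from smooth_on_linear_family[OF open_TS, where Q="\<lambda>p. pinv (fst p)", OF base[OF smooth_pinv] _ this]
  have "smooth_on TS (\<lambda>p. pinv (fst p) (D2 (fst p) (snd p) (snd p)))"
    using linear_pinv by auto
  then show ?thesis
    using smooth_snd unfolding spray_def[abs_def] smooth_on_def
    by (auto intro!: Ck_on_Pair[OF open_TS] Ck_on_minus[OF open_TS])
qed

lemma image_curve_velocity:
  assumes "c s \<in> S" "(c has_vector_derivative v) (at s)"
  shows "((\<lambda>s. f (c s)) has_vector_derivative D (c s) v) (at s)"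
  using has_derivative_compose[OF assms(2)[unfolded has_vector_derivative_def] D_has_derivative[OF assms(1)]]
  by (simp add: has_vector_derivative_def linear_scale[OF linear_D[OF assms(1)]])

lemma image_curve_acceleration:
  assumes "c s \<in> S" "(c has_vector_derivative v s) (at s)" "(v has_vector_derivative a) (at s)"
  shows "((\<lambda>s. D (c s) (v s)) has_vector_derivative D2 (c s) (v s) (v s) + D (c s) a) (at s)"
proof -
  have "((\<lambda>s. D (c s) (v s)) has_derivative
      (\<lambda>h. frechet_derivative (\<lambda>u. D u (v s)) (at (c s)) (h *\<^sub>R v s) + D (c s) (h *\<^sub>R a))) (at s)"
    using assms(2,3) unfolding has_vector_derivative_def
    by (intro has_derivative_linear_family[OF open_S, where Q=D] assms(1)
        smooth_on_differentiable[OF smooth_D] linear_D)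
  then show ?thesis
    unfolding D2_def[symmetric]
    by (simp add: has_vector_derivative_def linear_scale[OF linear_D[OF assms(1)]]
        linear_scale[OF linear_D2[OF assms(1)]] scaleR_right_distrib)
qed

text \<open>
  A curve in coordinates is a geodesic exactly if the acceleration of its image is normal. By the
  preceding lemma the left-hand side below is the tangential part of this acceleration.
\<close>

lemma normal_acceleration_iff:
  assumes "u \<in> S"
  shows "tproj u (D2 u v v + D u a) = 0 \<longleftrightarrow> a = - pinv u (D2 u v v)"
proof -
  have "tproj u (D2 u v v + D u a) = D u (pinv u (D2 u v v) + a)"
    using assms linear_add[OF linear_tproj] linear_add[OF linear_D] by (simp add: tproj_def)
  also have "\<dots> = 0 \<longleftrightarrow> pinv u (D2 u v v) + a = 0"
    using inj_D[OF assms, of _ 0] linear_0[OF linear_D[OF assms]] by metis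
  finally show ?thesis by (simp add: add_eq_0_iff)
qed

definition flow_line :: "real set \<Rightarrow> (real \<Rightarrow> (real^'k) \<times> (real^'k)) \<Rightarrow> bool"
  where "flow_line J X \<longleftrightarrow> open J \<and> (\<forall>t\<in>J. X t \<in> TS \<and> (X has_vector_derivative spray (X t)) (at t))"

lemma flow_line_components:
  assumes "flow_line J X" "t \<in> J"
  shows "fst (X t) \<in> S" "((\<lambda>t. fst (X t)) has_vector_derivative snd (X t)) (at t)"
    "((\<lambda>t. snd (X t)) has_vector_derivative
       - pinv (fst (X t)) (D2 (fst (X t)) (snd (X t)) (snd (X t)))) (at t)"
  using assms bounded_linear.has_vector_derivative[OF bounded_linear_fst, of X "spray (X t)" "at t"]
    bounded_linear.has_vector_derivative[OF bounded_linear_snd, of X "spray (X t)" "at t"]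
  by (auto simp: flow_line_def spray_def)

lemma flow_line_iff:
  assumes "open J"
  shows "flow_line J (\<lambda>t. (c t, v t)) \<longleftrightarrow>
    (\<forall>t\<in>J. c t \<in> S \<and> (c has_vector_derivative v t) (at t) \<and>
      (v has_vector_derivative - pinv (c t) (D2 (c t) (v t) (v t))) (at t))"
proof
  show "flow_line J (\<lambda>t. (c t, v t))" if "\<forall>t\<in>J. c t \<in> S \<and> (c has_vector_derivative v t) (at t) \<and>
      (v has_vector_derivative - pinv (c t) (D2 (c t) (v t) (v t))) (at t)"
    using that assms by (auto simp: flow_line_def spray_def intro: has_vector_derivative_Pair)
qed (use flow_line_components in fastforce)

text \<open>
  The spray is quadratic in the velocity, so a geodesic run at \<open>s\<close> times its speed is again a
  geodesic. Therefore short initial velocities can be traded for short times.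
\<close>

lemma flow_line_scale:
  assumes "flow_line J X"
  shows "flow_line ((\<lambda>t. s * t) -` J) (\<lambda>t. (fst (X (s * t)), s *\<^sub>R snd (X (s * t))))"
proof -
  have "open J" using assms by (simp add: flow_line_def)
  then have op: "open ((\<lambda>t. s * t) -` J)"
    by (intro open_vimage continuous_intros)
  show ?thesis
  proof (subst flow_line_iff[OF op], intro ballI conjI)
    fix t assume "t \<in> (\<lambda>t. s * t) -` J"
    then have t: "s * t \<in> J" by simp
    note X = flow_line_components[OF assms t]
    show "fst (X (s * t)) \<in> S" by (rule X)
    show "((\<lambda>t. fst (X (s * t))) has_vector_derivative s *\<^sub>R snd (X (s * t))) (at t)"
      by (rule has_vector_derivative_rescale[OF X(2)])
    have "((\<lambda>t. s *\<^sub>R snd (X (s * t))) has_vector_derivative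
       s *\<^sub>R s *\<^sub>R - pinv (fst (X (s * t))) (D2 (fst (X (s * t))) (snd (X (s * t))) (snd (X (s * t))))) (at t)"
      by (rule bounded_linear.has_vector_derivative[OF bounded_linear_scaleR_right has_vector_derivative_rescale[OF X(3)]])
    then show "((\<lambda>t. s *\<^sub>R snd (X (s * t))) has_vector_derivative
       - pinv (fst (X (s * t))) (D2 (fst (X (s * t))) (s *\<^sub>R snd (X (s * t))) (s *\<^sub>R snd (X (s * t))))) (at t)"
      by (simp add: linear_scale[OF linear_pinv[OF X(1)]] linear_scale[OF linear_D2[OF X(1)]]
          linear_scale[OF linear_D2'[OF X(1)]])
  qed
qed

text \<open>
  The first three derivatives of a geodesic \<open>y\<close> in the ambient space. As \<open>y'\<close> is tangent and \<open>y''\<close>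
  is normal, \<open>y'' = sff y' y'\<close>. In the derivative of this equation the term \<open>sff y'' y'\<close> vanishes and
  \<open>sff y' y''\<close> is tangent, so the normal part of \<open>y'''\<close> is the normal part of \<open>dsff\<close>, which is the
  covariant derivative of the second fundamental form. The tangential part follows from
  differentiating \<open>tproj y'' = 0\<close>.
\<close>

lemma image_geodesic_derivatives:
  assumes fl: "flow_line J X" and t: "t \<in> J"
  defines "c \<equiv> \<lambda>t. fst (X t)" and "v \<equiv> \<lambda>t. snd (X t)"
  defines "y1 \<equiv> \<lambda>t. D (c t) (v t)"
  defines "y2 \<equiv> \<lambda>t. sff (c t) (y1 t) (y1 t)"
  defines "y3 \<equiv> \<lambda>t. dsff (c t) (v t) (y1 t) (y1 t) - tproj (c t) (dsff (c t) (v t) (y1 t) (y1 t))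
      - dtproj (c t) (v t) (y2 t)"
  shows "((\<lambda>t. f (c t)) has_vector_derivative y1 t) (at t)"
    and "(y1 has_vector_derivative y2 t) (at t)"
    and "(y2 has_vector_derivative y3 t) (at t)"
    and "tproj (c t) (y2 t) = 0"
proof -
  have cS: "c t \<in> S" and c: "(c has_vector_derivative v t) (at t)"
    and v: "(v has_vector_derivative - pinv (c t) (D2 (c t) (v t) (v t))) (at t)" if "t \<in> J" for t
    using flow_line_components[OF fl that] by (simp_all add: c_def v_def)
  have D2y: "y2 t = D2 (c t) (v t) (v t) + D (c t) (- pinv (c t) (D2 (c t) (v t) (v t)))" if "t \<in> J" for t
    using cS[OF that] by (simp add: y2_def y1_def sff_D D2_normal linear_neg[OF linear_D] tproj_def)
  show "((\<lambda>t. f (c t)) has_vector_derivative y1 t) (at t)"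
    unfolding y1_def by (rule image_curve_velocity[OF cS c]) (rule t)+
  have y1: "(y1 has_vector_derivative y2 t) (at t)" if "t \<in> J" for t
    unfolding D2y[OF that] unfolding y1_def
    by (rule image_curve_acceleration[OF cS c v]) (rule that)+
  show "(y1 has_vector_derivative y2 t) (at t)" by (rule y1[OF t])
  have Py2: "tproj (c t) (y2 t) = 0" if "t \<in> J" for t
    unfolding D2y[OF that] by (subst normal_acceleration_iff[OF cS[OF that]]) simp
  show "tproj (c t) (y2 t) = 0" by (rule Py2[OF t])
  let ?dsff = "dsff (c t) (v t) (y1 t) (y1 t)" and ?Py = "dtproj (c t) (v t) (y2 t)"
  note cS = cS[OF t]
  define z where "z = ?dsff + sff (c t) (y2 t) (y1 t) + sff (c t) (y1 t) (y2 t)"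
  have "((\<lambda>s. sff (c s) (y1 s) (y1 s)) has_derivative
    (\<lambda>h. dsff (c t) (h *\<^sub>R v t) (y1 t) (y1 t) + sff (c t) (h *\<^sub>R y2 t) (y1 t) + sff (c t) (y1 t) (h *\<^sub>R y2 t))) (at t)"
    using c[OF t] y1[OF t] cS unfolding has_vector_derivative_def by (intro sff_has_derivative)
  moreover have "dsff (c t) (h *\<^sub>R v t) x y = h *\<^sub>R dsff (c t) (v t) x y" for h x y
    unfolding dsff_def
    by (rule linear_scale[OF has_derivative_linear[OF smooth_on_has_derivative[OF smooth_sff cS]]])
  ultimately have z: "(y2 has_vector_derivative z) (at t)"
    unfolding z_def y2_def[symmetric] has_vector_derivative_def
    by (simp add: scaleR_right_distrib linear_scale[OF linear_sff1[OF cS]]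
        linear_scale[OF linear_sff2[OF cS]] y2_def[abs_def])
  have z': "z = ?dsff + ?Py"
    using sff_normal_left[OF cS Py2[OF t]] by (simp add: z_def y1_def sff_D[OF cS])
  have "((\<lambda>s. tproj (c s) (y2 s)) has_derivative (\<lambda>h. dtproj (c t) (h *\<^sub>R v t) (y2 t) + tproj (c t) (h *\<^sub>R z))) (at t)"
    unfolding dtproj_def using c[OF t] z unfolding has_vector_derivative_def
    by (intro has_derivative_linear_family[OF open_S, where Q=tproj] cS
        smooth_on_differentiable[OF smooth_tproj] linear_tproj)
  then have "((\<lambda>s. 0) has_derivative (\<lambda>h. dtproj (c t) (h *\<^sub>R v t) (y2 t) + tproj (c t) (h *\<^sub>R z))) (at t)"
    by (rule has_derivative_transform_within_open[of _ _ _ _ J])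
      (use fl t Py2 in \<open>auto simp: flow_line_def\<close>)
  from has_derivative_unique[OF this has_derivative_const]
  have "dtproj (c t) (1 *\<^sub>R v t) (y2 t) + tproj (c t) (1 *\<^sub>R z) = 0" by metis
  then have "?Py + tproj (c t) z = 0" by simp
  moreover have "tproj (c t) z = tproj (c t) ?dsff + ?Py"
    unfolding z' using linear_add[OF linear_tproj[OF cS]] tproj_dtproj_normal[OF cS Py2[OF t]] by simp
  ultimately have "tproj (c t) ?dsff + ?Py + ?Py = 0" by (simp add: algebra_simps)
  then have "z = y3 t" unfolding z' y3_def by (simp add: algebra_simps eq_neg_iff_add_eq_0)
  then show "(y2 has_vector_derivative y3 t) (at t)" using z by simp
qed

text \<open>
  The expansion in coordinates. A geodesic with a short initial velocity \<open>w\<close> is obtained from one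
  whose initial velocity \<open>w'\<close> has norm at most \<open>r\<close>, by running it at the speed \<open>s = norm w / r\<close>. The
  fourth derivative of the latter is bounded by a constant \<open>K\<close> on the uniform existence interval, so
  that of the former is at most \<open>s ^ 4 * K\<close>, and Taylor's formula at time 1 gives the bound
  \<open>C * norm w ^ 4\<close>.
\<close>

lemma geodesic_family:
  assumes u0: "u0 \<in> S"
  shows "\<exists>\<rho>>0. \<exists>C\<ge>0. \<forall>w. norm w < \<rho> \<longrightarrow> (\<exists>J X. is_interval J \<and> {0..1} \<subseteq> J \<and> flow_line J X \<and>
    X 0 = (u0, w) \<and>
    norm (f (fst (X 1)) - (f u0 + D u0 w + (1/2) *\<^sub>R sff u0 (D u0 w) (D u0 w)
      + (1/6) *\<^sub>R (dsff u0 w (D u0 w) (D u0 w) - tproj u0 (dsff u0 w (D u0 w) (D u0 w))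
          - dtproj u0 w (sff u0 (D u0 w) (D u0 w))))) \<le> C * norm w ^ 4)"
proof -
  define h where "h m = (lie spray ^^ m) (\<lambda>p. f (fst p))" for m
  have h0: "smooth_on TS (\<lambda>p. f (fst p))"
    by (rule smooth_on_compose[OF open_TS smooth_fst smooth_f]) auto
  have h: "smooth_on TS (h m)" for m
    unfolding h_def by (rule smooth_lie_power[OF open_TS smooth_spray h0])
  have h_Suc: "h (Suc m) = lie spray (h m)" for m by (simp add: h_def)
  let ?p0 = "(u0, 0) :: (real^'k) \<times> (real^'k)"
  have p0: "?p0 \<in> TS" using u0 by simp
  obtain r' L where r': "r' > 0" "L \<ge> 0" "cball ?p0 r' \<subseteq> TS" and
    lip: "\<And>p q. p \<in> cball ?p0 r' \<Longrightarrow> q \<in> cball ?p0 r' \<Longrightarrow> norm (spray p - spray q) \<le> L * norm (p - q)"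
    by (rule C1_locally_lipschitz[OF open_TS smooth_onD[OF smooth_spray] p0]) (rule that)
  define r where "r = r' / 2"
  have r: "r > 0" "2 * r = r'" using r' by (simp_all add: r_def)
  have "\<exists>e>0. \<forall>a\<in>cball ?p0 r. \<exists>X. X 0 = a \<and>
    (\<forall>t\<in>{-e<..<e}. X t \<in> cball ?p0 (2*r) \<and> (X has_vector_derivative spray (X t)) (at t))"
    by (rule picard_lindelof_autonomous[OF r(1) r'(2)]) (simp add: r(2) lip)
  then obtain e where e: "e > 0" and sol: "\<And>a. a \<in> cball ?p0 r \<Longrightarrow> \<exists>X. X 0 = a \<and>
    (\<forall>t\<in>{-e<..<e}. X t \<in> cball ?p0 r' \<and> (X has_vector_derivative spray (X t)) (at t))"
    by (auto simp: r(2))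
  have "continuous_on (cball ?p0 r') (h 4)"
    using smooth_on_continuous_on[OF h] r'(3) continuous_on_subset by blast
  then have "bounded (h 4 ` cball ?p0 r')"
    by (intro compact_imp_bounded compact_continuous_image compact_cball)
  then obtain K where K: "K > 0" "\<And>p. p \<in> cball ?p0 r' \<Longrightarrow> norm (h 4 p) \<le> K"
    by (auto simp: bounded_pos)
  define C where "C = DIM(real^'n) * K / r ^ 4"
  show ?thesis
  proof (rule exI[of _ "r * e"], intro conjI exI[of _ C] allI impI)
    show "r * e > 0" using r e by simp
    show "C \<ge> 0" using r e K by (simp add: C_def)
    fix w :: "real^'k" assume w: "norm w < r * e"
    define s where "s = norm w / r"
    \<comment> \<open>For \<open>w = 0\<close> both \<open>s\<close> and \<open>w'\<close> are 0, and \<open>s *\<^sub>R w' = w\<close> still holds.\<close>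
    define w' where "w' = (r / norm w) *\<^sub>R w"
    have s: "0 \<le> s" "s < e" using r w by (simp_all add: s_def divide_less_eq mult.commute)
    have sw: "s *\<^sub>R w' = w" using r by (simp add: s_def w'_def)
    have "norm w' \<le> r" using r by (simp add: w'_def)
    then have "(u0, w') \<in> cball ?p0 r" by (simp add: dist_Pair_Pair)
    then obtain X where X0: "X 0 = (u0, w')" and
      X: "\<And>t. t \<in> {-e<..<e} \<Longrightarrow> X t \<in> cball ?p0 r' \<and> (X has_vector_derivative spray (X t)) (at t)"
      using sol by blast
    have flX: "flow_line {-e<..<e} X" using X r'(3) by (auto simp: flow_line_def)
    define J where "J = (\<lambda>t. s * t) -` {-e<..<e}"
    define Z where "Z = (\<lambda>t. (fst (X (s * t)), s *\<^sub>R snd (X (s * t))))"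
    have fl: "flow_line J Z" unfolding J_def Z_def by (rule flow_line_scale[OF flX])
    then have opJ: "open J" by (simp add: flow_line_def)
    have J01: "t \<in> J" if "t \<in> {0..1}" for t
    proof -
      have "s * t \<le> s * 1" using that s by (intro mult_left_mono) auto
      moreover have "0 \<le> s * t" using that s by simp
      ultimately show ?thesis using s e by (simp add: J_def)
    qed
    have int: "is_interval J"
      unfolding is_interval_1
    proof (intro ballI allI impI)
      fix a b x assume "a \<in> J" "b \<in> J" "a \<le> x \<and> x \<le> b"
      then show "x \<in> J"
        using mult_left_mono[of a x s] mult_left_mono[of x b s] s by (auto simp: J_def)
    qed
    have Z0: "Z 0 = (u0, w)" by (simp add: Z_def X0 sw)
    \<comment> \<open>The \<open>m\<close>-th derivative of the slowed-down geodesic in the ambient space, in a form that shows the factor \<open>s ^ m\<close>.\<close>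
    define y where "y m t = s ^ m *\<^sub>R h m (X (s * t))" for m t
    have y: "(y m has_vector_derivative y (Suc m) t) (at t)" if "t \<in> J" for m t
    proof -
      have "s * t \<in> {-e<..<e}" using that by (simp add: J_def)
      then have "((\<lambda>t. h m (X t)) has_vector_derivative h (Suc m) (X (s * t))) (at (s * t))"
        unfolding h_Suc using X r'(3) by (intro lie_along_solution[OF h]) auto
      from bounded_linear.has_vector_derivative[OF bounded_linear_scaleR_right
          has_vector_derivative_rescale[OF this], of "s ^ m"]
      show ?thesis by (simp add: y_def[abs_def] mult.commute)
    qed
    note gd = image_geodesic_derivatives[OF fl]
    have y0: "y 0 t = f (fst (Z t))" for t by (simp add: y_def h_def Z_def)
    have y1: "y 1 t = D (fst (Z t)) (snd (Z t))" if "t \<in> J" for t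
      using vector_derivative_eq_on_open[OF opJ that y0 y[OF that] gd(1)[OF that]] by simp
    have y2: "y 2 t = sff (fst (Z t)) (D (fst (Z t)) (snd (Z t))) (D (fst (Z t)) (snd (Z t)))"
      if "t \<in> J" for t
      using vector_derivative_eq_on_open[OF opJ that y1 y[OF that] gd(2)[OF that]]
      by (simp add: numeral_2_eq_2)
    have "0 \<in> J" using J01 by simp
    have y3: "y 3 0 = dsff u0 w (D u0 w) (D u0 w) - tproj u0 (dsff u0 w (D u0 w) (D u0 w))
          - dtproj u0 w (sff u0 (D u0 w) (D u0 w))"
      using vector_derivative_eq_on_open[OF opJ \<open>0 \<in> J\<close> y2 y[OF \<open>0 \<in> J\<close>] gd(3)[OF \<open>0 \<in> J\<close>]]
      by (simp add: numeral_3_eq_3 numeral_2_eq_2 Z0)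
    have y4: "norm (y 4 t) \<le> s ^ 4 * K" if "t \<in> {0..1}" for t
      using X[of "s * t"] J01[OF that] K(2)[of "X (s * t)"] s
      by (auto simp: y_def J_def intro!: mult_left_mono)
    have "norm (y 0 1 - (\<Sum>m<4. (1 / fact m) *\<^sub>R y m 0)) \<le> DIM(real^'n) * (s ^ 4 * K)"
      by (rule taylor_remainder_bound[OF _ y[OF J01] y4]) simp_all
    also have "DIM(real^'n) * (s ^ 4 * K) = C * norm w ^ 4"
      by (simp add: C_def s_def power_divide)
    also have "(\<Sum>m<4. (1 / fact m) *\<^sub>R y m 0)
        = y 0 0 + y 1 0 + (1/2) *\<^sub>R y 2 0 + (1/6) *\<^sub>R y 3 0"
      by (simp add: eval_nat_numeral)
    finally show "\<exists>J X. is_interval J \<and> {0..1} \<subseteq> J \<and> flow_line J X \<and> X 0 = (u0, w) \<and>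
      norm (f (fst (X 1)) - (f u0 + D u0 w + (1/2) *\<^sub>R sff u0 (D u0 w) (D u0 w)
        + (1/6) *\<^sub>R (dsff u0 w (D u0 w) (D u0 w) - tproj u0 (dsff u0 w (D u0 w) (D u0 w))
          - dtproj u0 w (sff u0 (D u0 w) (D u0 w))))) \<le> C * norm w ^ 4"
      using y1[OF \<open>0 \<in> J\<close>] y2[OF \<open>0 \<in> J\<close>] y3 int J01 fl Z0
      by (intro exI[of _ J] exI[of _ Z]) (auto simp: y0)
  qed
qed

end

section \<open>Submanifolds in a chart\<close>

text \<open>
  Over a chart domain every intrinsic notion is now identified with its coordinate expression from
  the locale of parametrized immersions. The tangent space and the directional derivative are
  defined by means of all charts at a point, so the first task is to compare two charts.
\<close>

locale immersed_chart =
  fixes M :: "('m, 'k::finite, 'n::finite) submanifold" and U :: "'m set" and \<phi> :: "'m \<Rightarrow> real^'k"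
  assumes M: "immersed_submanifold M" and chart: "(U, \<phi>) \<in> atlas M"

sublocale immersed_chart \<subseteq> parametrized_immersion "\<phi> ` U" "imm M \<circ> inv_into U \<phi>"
proof
  have "smooth_manifold (mtop M) (atlas M)" using M by (simp add: immersed_submanifold_def)
  then have "\<forall>(U, \<phi>)\<in>atlas M. openin (mtop M) U \<and> open (\<phi> ` U) \<and>
      homeomorphic_map (subtopology (mtop M) U) (top_of_set (\<phi> ` U)) \<phi>"
    unfolding smooth_manifold_def by blast
  then show "open (\<phi> ` U)" using chart by blast
  have *: "\<forall>(U, \<phi>)\<in>atlas M. smooth_on (\<phi> ` U) (imm M \<circ> inv_into U \<phi>) \<and>
        (\<forall>z\<in>\<phi> ` U. inj (frechet_derivative (imm M \<circ> inv_into U \<phi>) (at z)))"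
    using M unfolding immersed_submanifold_def by blast
  show "smooth_on (\<phi> ` U) (imm M \<circ> inv_into U \<phi>)" using * chart by blast
  show "inj (frechet_derivative (imm M \<circ> inv_into U \<phi>) (at u))" if "u \<in> \<phi> ` U" for u
    using * chart that by blast
qed

context immersed_chart
begin

abbreviation \<psi> :: "real^'k \<Rightarrow> 'm" where "\<psi> \<equiv> inv_into U \<phi>"

lemma openin_chart: "openin (mtop M) U"
  and homeomorphic_chart: "homeomorphic_map (subtopology (mtop M) U) (top_of_set (\<phi> ` U)) \<phi>"
proof -
  have "smooth_manifold (mtop M) (atlas M)" using M by (simp add: immersed_submanifold_def)
  then have "\<forall>(U, \<phi>)\<in>atlas M. openin (mtop M) U \<and> open (\<phi> ` U) \<and>
      homeomorphic_map (subtopology (mtop M) U) (top_of_set (\<phi> ` U)) \<phi>"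
    unfolding smooth_manifold_def by blast
  then show "openin (mtop M) U"
    "homeomorphic_map (subtopology (mtop M) U) (top_of_set (\<phi> ` U)) \<phi>" using chart by blast+
qed

lemma topspace_chart: "topspace (mtop M) \<inter> U = U"
  using openin_subset[OF openin_chart] by auto

lemma inj_chart: "inj_on \<phi> U"
  using homeomorphic_chart by (simp add: homeomorphic_eq_everything_map topspace_chart)

lemma inv_chart [simp]: "p \<in> U \<Longrightarrow> \<psi> (\<phi> p) = p"
  by (rule inv_into_f_f[OF inj_chart])

lemma chart_inv [simp]: "u \<in> \<phi> ` U \<Longrightarrow> \<phi> (\<psi> u) = u"
  by (rule f_inv_into_f)

lemma inv_in_chart [simp]: "u \<in> \<phi> ` U \<Longrightarrow> \<psi> u \<in> U"
  by (rule inv_into_into)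

lemma continuous_map_inv_chart: "continuous_map (top_of_set (\<phi> ` U)) (mtop M) \<psi>"
proof -
  obtain g where g: "homeomorphic_maps (subtopology (mtop M) U) (top_of_set (\<phi> ` U)) \<phi> g"
    using homeomorphic_chart homeomorphic_map_maps by blast
  have "continuous_map (top_of_set (\<phi> ` U)) (subtopology (mtop M) U) \<psi>"
  proof (rule continuous_map_eq[of _ _ g])
    show "continuous_map (top_of_set (\<phi> ` U)) (subtopology (mtop M) U) g"
      using g by (simp add: homeomorphic_maps_def)
    show "g u = \<psi> u" if "u \<in> topspace (top_of_set (\<phi> ` U))" for u
      using g that by (auto simp: homeomorphic_maps_def topspace_chart)
  qed
  then show ?thesis by (simp add: continuous_map_in_subtopology)
qed

lemma open_chart_image:
  assumes "openin (mtop M) W"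
  shows "open (\<phi> ` (U \<inter> W))"
proof -
  have "openin (top_of_set (\<phi> ` U)) (\<phi> ` (U \<inter> W))"
    using homeomorphic_imp_open_map[OF homeomorphic_chart] assms
    by (simp add: open_map_def openin_subtopology_Int2)
  then show ?thesis using open_S openin_open_trans by blast
qed

lemma transition_smooth:
  assumes "(V, \<eta>) \<in> atlas M"
  shows "smooth_on (\<phi> ` (U \<inter> V)) (\<eta> \<circ> \<psi>)"
proof -
  have "\<forall>(U, \<phi>)\<in>atlas M. \<forall>(V, \<psi>)\<in>atlas M. smooth_on (\<phi> ` (U \<inter> V)) (\<psi> \<circ> inv_into U \<phi>)"
    using M by (simp add: immersed_submanifold_def smooth_manifold_def)
  then show ?thesis using assms chart by blast
qed

end

lemma transfer_derivative:
  assumes "immersed_chart M U \<phi>" "immersed_chart M V \<eta>" "p \<in> U" "p \<in> V"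
    and Y: "((Y \<circ> inv_into V \<eta>) has_derivative Y') (at (\<eta> p))"
  shows "((Y \<circ> inv_into U \<phi>) has_derivative
    (\<lambda>w. Y' (frechet_derivative (\<eta> \<circ> inv_into U \<phi>) (at (\<phi> p)) w))) (at (\<phi> p))"
proof -
  interpret U: immersed_chart M U \<phi> by fact
  interpret V: immersed_chart M V \<eta> by fact
  have p: "\<phi> p \<in> \<phi> ` (U \<inter> V)" using assms by auto
  have "((\<eta> \<circ> inv_into U \<phi>) has_derivative frechet_derivative (\<eta> \<circ> inv_into U \<phi>) (at (\<phi> p))) (at (\<phi> p))"
    by (rule smooth_on_has_derivative[OF U.transition_smooth[OF V.chart] p])
  moreover have "(\<eta> \<circ> inv_into U \<phi>) (\<phi> p) = \<eta> p" using assms by simp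
  ultimately have "((\<lambda>u. (Y \<circ> inv_into V \<eta>) ((\<eta> \<circ> inv_into U \<phi>) u)) has_derivative
      (\<lambda>w. Y' (frechet_derivative (\<eta> \<circ> inv_into U \<phi>) (at (\<phi> p)) w))) (at (\<phi> p))"
    using has_derivative_compose[of "\<eta> \<circ> inv_into U \<phi>" _ "\<phi> p" UNIV "Y \<circ> inv_into V \<eta>" Y'] Y by simp
  then show ?thesis
    by (rule has_derivative_transform_within_open[OF _ U.open_chart_image[OF V.openin_chart] p]) auto
qed

context immersed_chart
begin

lemma chart_other: "(V, \<eta>) \<in> atlas M \<Longrightarrow> immersed_chart M V \<eta>"
  using M by unfold_locales

lemma tangent_space_chart:
  assumes "p \<in> U"
  shows "tangent_space M p = range (D (\<phi> p))"
proof
  show "range (D (\<phi> p)) \<subseteq> tangent_space M p"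
    using assms chart unfolding tangent_space_def D_def by blast
  show "tangent_space M p \<subseteq> range (D (\<phi> p))"
  proof
    fix x assume "x \<in> tangent_space M p"
    then obtain V \<eta> w where V: "(V, \<eta>) \<in> atlas M" "p \<in> V"
      and x: "x = frechet_derivative (imm M \<circ> inv_into V \<eta>) (at (\<eta> p)) w"
      unfolding tangent_space_def by blast
    interpret V: immersed_chart M V \<eta> by (rule chart_other[OF V(1)])
    have "((imm M \<circ> \<psi>) has_derivative D (\<phi> p)) (at (\<phi> p))"
      using assms by (intro D_has_derivative) simp
    from frechet_derivative_at[OF transfer_derivative[OF V.immersed_chart_axioms immersed_chart_axioms V(2) assms this]]
    show "x \<in> range (D (\<phi> p))" unfolding x by (metis rangeI)
  qed
qed

lemma tangent_space_iff:
  assumes "p \<in> U"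
  shows "x \<in> tangent_space M p \<longleftrightarrow> tproj (\<phi> p) x = x"
proof
  show "tproj (\<phi> p) x = x" if "x \<in> tangent_space M p"
    using that assms by (auto simp: tangent_space_chart[OF assms])
  show "x \<in> tangent_space M p" if "tproj (\<phi> p) x = x"
    unfolding tangent_space_chart[OF assms]
    by (rule range_eqI[of _ _ "pinv (\<phi> p) x"]) (simp add: that tproj_def[symmetric])
qed

lemma normal_space_iff:
  assumes "p \<in> U"
  shows "x \<in> normal_space M p \<longleftrightarrow> tproj (\<phi> p) x = 0"
proof -
  have p: "\<phi> p \<in> \<phi> ` U" using assms by simp
  have "x \<in> normal_space M p \<longleftrightarrow> (\<forall>z. D (\<phi> p) z \<bullet> x = 0)"
    by (auto simp: normal_space_def orthogonal_comp_def tangent_space_chart[OF assms] orthogonal_def)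
  also have "\<dots> \<longleftrightarrow> pinv (\<phi> p) x = 0"
    unfolding pinv_iff[OF p] by (simp add: linear_0[OF linear_D[OF p]])
  finally show ?thesis using pinv_eq_0_iff[OF p] by simp
qed

lemma tan_part_chart:
  assumes "p \<in> U"
  shows "tan_part M p x = tproj (\<phi> p) x"
proof -
  have p: "\<phi> p \<in> \<phi> ` U" using assms by simp
  show ?thesis
    unfolding tan_part_def tangent_space_iff[OF assms] normal_space_iff[OF assms]
      linear_diff[OF linear_tproj[OF p]]
    by (rule the_equality) (simp_all add: tproj_tproj[OF p])
qed

lemma nor_part_chart:
  assumes "p \<in> U"
  shows "nor_part M p x = x - tproj (\<phi> p) x"
proof -
  have p: "\<phi> p \<in> \<phi> ` U" using assms by simp
  show ?thesis
    unfolding nor_part_def tangent_space_iff[OF assms] normal_space_iff[OF assms]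
      linear_diff[OF linear_tproj[OF p]]
    by (rule the_equality) (auto simp add: tproj_tproj[OF p] linear_diff[OF linear_tproj[OF p]])
qed

text \<open>
  A tangent vector has exactly one coordinate vector in each chart, since the immersion has an
  injective differential. The coordinate vectors in two charts correspond under the derivative of the
  transition map, hence all charts give the same value.
\<close>

lemma dir_deriv_chart:
  assumes p: "p \<in> U" and Y: "((Y \<circ> \<psi>) has_derivative Y') (at (\<phi> p))"
  shows "dir_deriv M p (D (\<phi> p) w) Y = Y' w"
  unfolding dir_deriv_def
proof (rule the_equality)
  have "Y' w = frechet_derivative (Y \<circ> \<psi>) (at (\<phi> p)) w"
    using frechet_derivative_at[OF Y] by simp
  then show "\<exists>(V, \<eta>)\<in>atlas M. \<exists>w'. p \<in> V \<and>
        D (\<phi> p) w = frechet_derivative (imm M \<circ> inv_into V \<eta>) (at (\<eta> p)) w' \<and>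
        Y' w = frechet_derivative (Y \<circ> inv_into V \<eta>) (at (\<eta> p)) w'"
    by (intro bexI[OF _ chart]) (auto simp: D_def p intro!: exI[of _ w])
next
  fix v
  assume "\<exists>(V, \<eta>)\<in>atlas M. \<exists>w'. p \<in> V \<and>
        D (\<phi> p) w = frechet_derivative (imm M \<circ> inv_into V \<eta>) (at (\<eta> p)) w' \<and>
        v = frechet_derivative (Y \<circ> inv_into V \<eta>) (at (\<eta> p)) w'"
  then obtain V \<eta> w' where V: "(V, \<eta>) \<in> atlas M" "p \<in> V"
    and x: "D (\<phi> p) w = frechet_derivative (imm M \<circ> inv_into V \<eta>) (at (\<eta> p)) w'"
    and v: "v = frechet_derivative (Y \<circ> inv_into V \<eta>) (at (\<eta> p)) w'" by blast
  interpret V: immersed_chart M V \<eta> by (rule chart_other[OF V(1)])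
  note tr = frechet_derivative_at[OF transfer_derivative[OF V.immersed_chart_axioms immersed_chart_axioms V(2) p], symmetric]
  have up: "\<phi> p \<in> \<phi> ` U" using p by simp
  have "D (\<phi> p) w = D (\<phi> p) (frechet_derivative (\<phi> \<circ> inv_into V \<eta>) (at (\<eta> p)) w')"
    unfolding x by (simp only: tr[OF D_has_derivative[OF up]])
  then have "w = frechet_derivative (\<phi> \<circ> inv_into V \<eta>) (at (\<eta> p)) w'"
    by (rule inj_D[OF up])
  then show "v = Y' w" unfolding v by (simp only: tr[OF Y])
qed

text \<open>
  Projecting a fixed tangent vector to the neighbouring tangent spaces gives a smooth tangent field
  extending it. This provides the existence part of the definite descriptions in the second
  fundamental form and its covariant derivative.
\<close>

lemma projected_field:
  assumes "q \<in> U" "y \<in> tangent_space M q"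
  shows "tangent_field_near M q (\<lambda>p. tproj (\<phi> p) y)" "tproj (\<phi> q) y = y"
proof -
  show "tproj (\<phi> q) y = y" using assms tangent_space_iff by blast
  have "smooth_on (\<eta> ` (V \<inter> U)) ((\<lambda>p. tproj (\<phi> p) y) \<circ> inv_into V \<eta>)" if V: "(V, \<eta>) \<in> atlas M" for V \<eta>
  proof -
    interpret V: immersed_chart M V \<eta> by (rule chart_other[OF V])
    have "smooth_on (\<eta> ` (V \<inter> U)) (\<lambda>v. tproj ((\<phi> \<circ> inv_into V \<eta>) v) y)"
      by (rule smooth_on_compose[OF V.open_chart_image[OF openin_chart] V.transition_smooth[OF chart] smooth_tproj]) auto
    then show ?thesis by (simp add: o_def)
  qed
  then show "tangent_field_near M q (\<lambda>p. tproj (\<phi> p) y)"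
    unfolding tangent_field_near_def
    using assms(1) openin_chart by (intro exI[of _ U]) (auto simp: tangent_space_iff)
qed

lemma tangent_field_chart:
  assumes "p \<in> U" "tangent_field_near M p Y"
  obtains T Y' where "open T" "T \<subseteq> \<phi> ` U" "\<phi> p \<in> T" "((Y \<circ> \<psi>) has_derivative Y') (at (\<phi> p))"
    "\<And>u. u \<in> T \<Longrightarrow> Y (\<psi> u) \<in> tangent_space M (\<psi> u)"
    "\<And>w. Y' w = dtproj (\<phi> p) w (Y p) + tproj (\<phi> p) (Y' w)"
proof -
  obtain W where W: "openin (mtop M) W" "p \<in> W" "\<And>q. q \<in> W \<Longrightarrow> Y q \<in> tangent_space M q"
    and sm: "smooth_on (\<phi> ` (U \<inter> W)) (Y \<circ> \<psi>)"
    using assms(2) chart unfolding tangent_field_near_def by blast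
  let ?T = "\<phi> ` (U \<inter> W)" and ?Y' = "frechet_derivative (Y \<circ> \<psi>) (at (\<phi> p))"
  have T: "open ?T" "?T \<subseteq> \<phi> ` U" "\<phi> p \<in> ?T"
    using open_chart_image[OF W(1)] assms(1) W(2) by auto
  have Y': "((Y \<circ> \<psi>) has_derivative ?Y') (at (\<phi> p))"
    by (rule smooth_on_has_derivative[OF sm T(3)])
  have tan: "Y (\<psi> u) \<in> tangent_space M (\<psi> u)" if "u \<in> ?T" for u
    using that W(3) by auto
  have "?Y' w = dtproj (\<phi> p) w ((Y \<circ> \<psi>) (\<phi> p)) + tproj (\<phi> p) (?Y' w)" for w
    by (rule tangent_field_derivative[OF T Y'])
      (use tan T(2) tangent_space_iff in \<open>force\<close>)
  then show thesis using that[OF T Y' tan] assms(1) by simp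
qed

lemma D_pinv_tangent: "p \<in> U \<Longrightarrow> x \<in> tangent_space M p \<Longrightarrow> D (\<phi> p) (pinv (\<phi> p) x) = x"
  using tangent_space_iff unfolding tproj_def by blast

lemma second_ff_chart:
  assumes p: "p \<in> U" and x: "x \<in> tangent_space M p" and y: "y \<in> tangent_space M p"
  shows "second_ff M p x y = sff (\<phi> p) x y"
proof -
  have eq: "nor_part M p (dir_deriv M p x Y) = sff (\<phi> p) x y"
    if Y: "tangent_field_near M p Y" "Y p = y" for Y
  proof -
    obtain T Y' where T: "((Y \<circ> \<psi>) has_derivative Y') (at (\<phi> p))"
      "\<And>w. Y' w = dtproj (\<phi> p) w (Y p) + tproj (\<phi> p) (Y' w)"
      by (rule tangent_field_chart[OF p Y(1)]) (rule that)
    have "dir_deriv M p x Y = Y' (pinv (\<phi> p) x)"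
      using dir_deriv_chart[OF p T(1), of "pinv (\<phi> p) x"] D_pinv_tangent[OF p x] by simp
    then show ?thesis
      using T(2)[of "pinv (\<phi> p) x"] Y(2) by (simp add: nor_part_chart[OF p] sff_def algebra_simps)
  qed
  show ?thesis
    unfolding second_ff_def
  proof (rule the_equality)
    show "\<exists>Y. tangent_field_near M p Y \<and> Y p = y \<and> sff (\<phi> p) x y = nor_part M p (dir_deriv M p x Y)"
      by (intro exI[of _ "\<lambda>q. tproj (\<phi> q) y"] conjI eq[symmetric] projected_field[OF p y])
  qed (use eq in auto)
qed

text \<open>
  Differentiate \<open>sff (Y, Z)\<close> by the product rule and take normal parts. By \<open>tangent_field_derivative\<close>
  the derivative of \<open>Y\<close> is the tangent connection plus a normal vector, and \<open>sff\<close> vanishes on a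
  normal first argument. In the second slot a normal vector contributes a tangent vector, which the
  normal projection removes. Only the term with \<open>dsff\<close> survives the subtraction, and it depends on
  the values of \<open>Y\<close> and \<open>Z\<close> alone.
\<close>

lemma cov_second_ff_chart:
  assumes p: "p \<in> U" and x: "x \<in> tangent_space M p" and y: "y \<in> tangent_space M p"
    and z: "z \<in> tangent_space M p"
  defines "d \<equiv> dsff (\<phi> p) (pinv (\<phi> p) x) y z"
  shows "cov_second_ff M p x y z = d - tproj (\<phi> p) d"
proof -
  let ?u = "\<phi> p" and ?w = "pinv (\<phi> p) x"
  have u: "?u \<in> \<phi> ` U" using p by simp
  have tan: "tproj ?u x = x" "tproj ?u y = y" "tproj ?u z = z" using x y z tangent_space_iff[OF p] by auto
  have eq: "nor_conn M p x (\<lambda>q. second_ff M q (Y q) (Z q))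
            - second_ff M p (tan_conn M p x Y) (Z p)
            - second_ff M p (Y p) (tan_conn M p x Z) = d - tproj ?u d"
    if Y: "tangent_field_near M p Y" "Y p = y" and Z: "tangent_field_near M p Z" "Z p = z" for Y Z
  proof -
    obtain T Y' where T: "open T" "T \<subseteq> \<phi> ` U" "?u \<in> T" "((Y \<circ> \<psi>) has_derivative Y') (at ?u)"
      "\<And>u. u \<in> T \<Longrightarrow> Y (\<psi> u) \<in> tangent_space M (\<psi> u)"
      and Y': "\<And>w. Y' w = dtproj ?u w (Y p) + tproj ?u (Y' w)"
      by (rule tangent_field_chart[OF p Y(1)]) (rule that)
    obtain R Z' where R: "open R" "R \<subseteq> \<phi> ` U" "?u \<in> R" "((Z \<circ> \<psi>) has_derivative Z') (at ?u)"
      "\<And>u. u \<in> R \<Longrightarrow> Z (\<psi> u) \<in> tangent_space M (\<psi> u)"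
      and Z': "\<And>w. Z' w = dtproj ?u w (Z p) + tproj ?u (Z' w)"
      by (rule tangent_field_chart[OF p Z(1)]) (rule that)
    have dY: "dir_deriv M p x Y = Y' ?w" and dZ: "dir_deriv M p x Z = Z' ?w"
      using dir_deriv_chart[OF p T(4), of ?w] dir_deriv_chart[OF p R(4), of ?w] D_pinv_tangent[OF p x]
      by simp_all
    have "((\<lambda>v. sff v ((Y \<circ> \<psi>) v) ((Z \<circ> \<psi>) v)) has_derivative
        (\<lambda>h. dsff ?u h ((Y \<circ> \<psi>) ?u) ((Z \<circ> \<psi>) ?u) + sff ?u (Y' h) ((Z \<circ> \<psi>) ?u) + sff ?u ((Y \<circ> \<psi>) ?u) (Z' h))) (at ?u)"
      by (rule sff_has_derivative[where c="\<lambda>v. v", OF u has_derivative_ident T(4) R(4)])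
    then have "((\<lambda>v. sff v ((Y \<circ> \<psi>) v) ((Z \<circ> \<psi>) v)) has_derivative
        (\<lambda>h. dsff ?u h y z + sff ?u (Y' h) z + sff ?u y (Z' h))) (at ?u)"
      using p Y(2) Z(2) by simp
    then have "(((\<lambda>q. second_ff M q (Y q) (Z q)) \<circ> \<psi>) has_derivative
        (\<lambda>h. dsff ?u h y z + sff ?u (Y' h) z + sff ?u y (Z' h))) (at ?u)"
    proof (rule has_derivative_transform_within_open[of _ _ _ _ "T \<inter> R"])
      fix v assume v: "v \<in> T \<inter> R"
      then have "v \<in> \<phi> ` U" using T(2) by auto
      then show "sff v ((Y \<circ> \<psi>) v) ((Z \<circ> \<psi>) v) = ((\<lambda>q. second_ff M q (Y q) (Z q)) \<circ> \<psi>) v"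
        using second_ff_chart[of "\<psi> v" "Y (\<psi> v)" "Z (\<psi> v)"] T(5) R(5) v by simp
    qed (use T R in auto)
    from dir_deriv_chart[OF p this, of ?w]
    have "dir_deriv M p x (\<lambda>q. second_ff M q (Y q) (Z q)) = d + sff ?u (Y' ?w) z + sff ?u y (Z' ?w)"
      using D_pinv_tangent[OF p x] by (simp add: d_def)
    moreover have "sff ?u (Y' ?w) z = sff ?u (tproj ?u (Y' ?w)) z"
      using u by (simp add: sff_def)
    moreover have "sff ?u y (Z' ?w) = sff ?u y (dtproj ?u ?w z) + sff ?u y (tproj ?u (Z' ?w))"
      using Z'[of ?w] linear_add[OF linear_sff2[OF u]] Z(2) by metis
    moreover have "tproj ?u (sff ?u (tproj ?u (Y' ?w)) z) = 0" "tproj ?u (sff ?u y (tproj ?u (Z' ?w))) = 0"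
      unfolding sff_def using tan u by (simp_all add: tproj_dtproj_tangent)
    moreover have "tproj ?u (sff ?u y (dtproj ?u ?w z)) = sff ?u y (dtproj ?u ?w z)"
      unfolding sff_def by (rule tproj_dtproj_normal[OF u tproj_dtproj_tangent[OF u tan(3)]])
    ultimately have "nor_conn M p x (\<lambda>q. second_ff M q (Y q) (Z q))
        = d - tproj ?u d + sff ?u (tproj ?u (Y' ?w)) z + sff ?u y (tproj ?u (Z' ?w))"
      by (simp add: nor_conn_def nor_part_chart[OF p] linear_add[OF linear_tproj[OF u]])
    moreover have "second_ff M p (tan_conn M p x Y) (Z p) = sff ?u (tproj ?u (Y' ?w)) z"
      "second_ff M p (Y p) (tan_conn M p x Z) = sff ?u y (tproj ?u (Z' ?w))"
      by (simp_all add: tan_conn_def tan_part_chart[OF p] dY dZ Y(2) Z(2) tangent_space_iff[OF p]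
          tan tproj_tproj[OF u] second_ff_chart[OF p])
    ultimately show ?thesis by simp
  qed
  show ?thesis
    unfolding cov_second_ff_def
  proof (rule the_equality)
    show "\<exists>Y Z. tangent_field_near M p Y \<and> tangent_field_near M p Z \<and> Y p = y \<and> Z p = z \<and>
        d - tproj ?u d = nor_conn M p x (\<lambda>q. second_ff M q (Y q) (Z q))
            - second_ff M p (tan_conn M p x Y) (Z p) - second_ff M p (Y p) (tan_conn M p x Z)"
      by (rule exI[of _ "\<lambda>q. tproj (\<phi> q) y"], rule exI[of _ "\<lambda>q. tproj (\<phi> q) z"])
        (intro conjI eq[symmetric] projected_field[OF p y] projected_field[OF p z])
  qed (use eq in auto)
qed

section \<open>Geodesics and the exponential map\<close>

text \<open>
  Smoothness of the curve is required in every chart of the atlas; outside of the given one it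
  comes from the transition maps.
\<close>

lemma flow_line_geodesic:
  assumes fl: "flow_line J X" and J: "is_interval J"
  defines "\<gamma> \<equiv> \<lambda>t. \<psi> (fst (X t))"
  shows "geodesic M J \<gamma>"
    and "\<And>t. t \<in> J \<Longrightarrow> velocity M \<gamma> t = D (fst (X t)) (snd (X t))"
proof -
  have opJ: "open J" using fl by (simp add: flow_line_def)
  have S: "fst (X t) \<in> \<phi> ` U" if "t \<in> J" for t by (rule flow_line_components(1)[OF fl that])
  have smX: "smooth_on J X"
    by (rule ode_solution_smooth[OF smooth_spray opJ]) (use fl in \<open>auto simp: flow_line_def\<close>)
  have smc: "smooth_on J (\<lambda>t. fst (X t))"
    unfolding smooth_on_def
    by (auto intro!: Ck_on_bounded_linear[OF opJ bounded_linear_fst] smooth_onD[OF smX])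
  have contc: "continuous_on J (\<lambda>t. fst (X t))"
    by (rule smooth_on_continuous_on[OF smc])
  have vel: "velocity M \<gamma> t = D (fst (X t)) (snd (X t))" if "t \<in> J" for t
    unfolding velocity_def \<gamma>_def
    using vector_derivative_at[OF image_geodesic_derivatives(1)[OF fl that]] by (simp add: o_def)
  then show "\<And>t. t \<in> J \<Longrightarrow> velocity M \<gamma> t = D (fst (X t)) (snd (X t))" .
  have cm: "continuous_map (top_of_set J) (mtop M) \<gamma>"
  proof -
    have "continuous_map (top_of_set J) (top_of_set (\<phi> ` U)) (\<lambda>t. fst (X t))"
      using contc S by (auto simp: continuous_map_in_subtopology)
    from continuous_map_compose[OF this continuous_map_inv_chart]
    show ?thesis by (simp add: \<gamma>_def o_def)
  qed
  have "smooth_on {t\<in>J. \<gamma> t \<in> V} (\<eta> \<circ> \<gamma>)" if V: "(V, \<eta>) \<in> atlas M" for V \<eta>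
  proof -
    interpret V: immersed_chart M V \<eta> by (rule chart_other[OF V])
    have "openin (top_of_set J) {t \<in> topspace (top_of_set J). \<gamma> t \<in> V}"
      by (rule openin_continuous_map_preimage[OF cm V.openin_chart])
    then have op: "open {t\<in>J. \<gamma> t \<in> V}" using opJ openin_open_trans by simp
    have "smooth_on {t\<in>J. \<gamma> t \<in> V} (\<lambda>t. (\<eta> \<circ> \<psi>) (fst (X t)))"
    proof (rule smooth_on_compose[OF op _ transition_smooth[OF V]])
      show "smooth_on {t\<in>J. \<gamma> t \<in> V} (\<lambda>t. fst (X t))"
        by (rule smooth_on_subset[OF smc]) auto
      show "(\<lambda>t. fst (X t)) ` {t\<in>J. \<gamma> t \<in> V} \<subseteq> \<phi> ` (U \<inter> V)"
      proof clarify
        fix t assume "t \<in> J" "\<gamma> t \<in> V"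
        then have "fst (X t) = \<phi> (\<gamma> t)" "\<gamma> t \<in> U \<inter> V"
          using S[of t] by (auto simp: \<gamma>_def)
        then show "fst (X t) \<in> \<phi> ` (U \<inter> V)" by blast
      qed
    qed
    then show ?thesis by (simp add: \<gamma>_def o_def)
  qed
  moreover have "cov_deriv_along M \<gamma> (velocity M \<gamma>) t = 0" if t: "t \<in> J" for t
  proof -
    note g = image_geodesic_derivatives[OF fl t]
    have "(velocity M \<gamma> has_vector_derivative
        sff (fst (X t)) (D (fst (X t)) (snd (X t))) (D (fst (X t)) (snd (X t)))) (at t)"
      by (rule has_vector_derivative_transform_within_open[OF g(2) opJ t]) (simp add: vel)
    from vector_derivative_at[OF this] show ?thesis
      using g(4) S[OF t] by (simp add: cov_deriv_along_def tan_part_chart \<gamma>_def)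
  qed
  ultimately show "geodesic M J \<gamma>"
    using opJ J cm by (auto simp: geodesic_def smooth_curve_def)
qed

lemma geodesic_flow_line:
  assumes g: "geodesic M I \<gamma>"
  defines "J \<equiv> {t\<in>I. \<gamma> t \<in> U}" and "c \<equiv> \<phi> \<circ> \<gamma>"
  defines "v \<equiv> \<lambda>t. vector_derivative c (at t)"
  shows "flow_line J (\<lambda>t. (c t, v t))"
    and "\<And>t. t \<in> J \<Longrightarrow> velocity M \<gamma> t = D (c t) (v t)"
proof -
  have opI: "open I" and cm: "continuous_map (top_of_set I) (mtop M) \<gamma>"
    and sm: "smooth_on J c"
    using g chart unfolding geodesic_def smooth_curve_def J_def c_def by auto
  have "openin (top_of_set I) {t \<in> topspace (top_of_set I). \<gamma> t \<in> U}"
    by (rule openin_continuous_map_preimage[OF cm openin_chart])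
  then have opJ: "open J" using opI openin_open_trans by (simp add: J_def)
  have c: "(c has_vector_derivative v t) (at t)" if "t \<in> J" for t
    unfolding v_def using smooth_on_differentiable[OF sm that]
    by (simp add: vector_derivative_works)
  have v: "(v has_vector_derivative vector_derivative v (at t)) (at t)" if t: "t \<in> J" for t
  proof -
    have "(\<lambda>s. frechet_derivative c (at s) 1) differentiable (at t)"
      by (rule smooth_on_differentiable[OF smooth_on_derivative[OF sm] t])
    then have "((\<lambda>s. frechet_derivative c (at s) 1) has_vector_derivative
        vector_derivative (\<lambda>s. frechet_derivative c (at s) 1) (at t)) (at t)"
      by (simp add: vector_derivative_works)
    then have "(v has_vector_derivative
        vector_derivative (\<lambda>s. frechet_derivative c (at s) 1) (at t)) (at t)"
    proof (rule has_vector_derivative_transform_within_open[OF _ opJ t])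
      fix s assume "s \<in> J"
      then show "frechet_derivative c (at s) 1 = v s"
        using frechet_derivative_at[OF c[unfolded has_vector_derivative_def]] by (metis scaleR_one)
    qed
    then show ?thesis using vector_derivative_at by metis
  qed
  have S: "c t \<in> \<phi> ` U" and \<gamma>: "\<psi> (c t) = \<gamma> t" if "t \<in> J" for t
    using that by (auto simp: c_def J_def)
  have vel: "velocity M \<gamma> t = D (c t) (v t)" if t: "t \<in> J" for t
  proof -
    have "((\<lambda>t. (imm M \<circ> \<psi>) (c t)) has_vector_derivative D (c t) (v t)) (at t)"
      by (rule image_curve_velocity[OF S[OF t] c[OF t]])
    then have "((imm M \<circ> \<gamma>) has_vector_derivative D (c t) (v t)) (at t)"
      by (rule has_vector_derivative_transform_within_open[OF _ opJ t]) (simp add: \<gamma>)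
    then show ?thesis unfolding velocity_def by (rule vector_derivative_at)
  qed
  then show "\<And>t. t \<in> J \<Longrightarrow> velocity M \<gamma> t = D (c t) (v t)" .
  have "vector_derivative v (at t) = - pinv (c t) (D2 (c t) (v t) (v t))" if t: "t \<in> J" for t
  proof -
    have "(velocity M \<gamma> has_vector_derivative
        D2 (c t) (v t) (v t) + D (c t) (vector_derivative v (at t))) (at t)"
      by (rule has_vector_derivative_transform_within_open[OF
            image_curve_acceleration[OF S[OF t] c[OF t] v[OF t]] opJ t]) (simp add: vel)
    from vector_derivative_at[OF this]
    have "tproj (c t) (D2 (c t) (v t) (v t) + D (c t) (vector_derivative v (at t))) = 0"
      using g t tan_part_chart[of "\<gamma> t"] by (auto simp: geodesic_def cov_deriv_along_def J_def c_def)
    then show ?thesis by (simp only: normal_acceleration_iff[OF S[OF t]])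
  qed
  then show "flow_line J (\<lambda>t. (c t, v t))"
    unfolding flow_line_iff[OF opJ] using S c v by metis
qed

text \<open>
  The geodesic \<open>\<gamma>\<close> may a priori leave the chart. The set of times in \<open>{0..1}\<close> at which it agrees
  with the geodesic constructed in the chart, together with the velocity, contains 0. It is open by
  local uniqueness for the spray. It is closed because the manifold is Hausdorff: a limit of
  common points is a common point, so \<open>\<gamma>\<close> is in the chart there and velocities can be compared.
  As \<open>{0..1}\<close> is connected, the curves agree up to time 1.
\<close>

lemma geodesic_unique:
  assumes fl: "flow_line J X" and J: "is_interval J" "{0..1} \<subseteq> J"
    and g: "geodesic M I \<gamma>" "{0..1} \<subseteq> I" and \<gamma>0: "\<gamma> 0 = \<psi> (fst (X 0))"
    and vel0: "velocity M \<gamma> 0 = D (fst (X 0)) (snd (X 0))"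
  shows "\<gamma> 1 = \<psi> (fst (X 1))"
proof -
  define \<beta> where "\<beta> = (\<lambda>t. \<psi> (fst (X t)))"
  define K where "K = {t\<in>I. \<gamma> t \<in> U}"
  define Y where "Y = (\<lambda>t. ((\<phi> \<circ> \<gamma>) t, vector_derivative (\<phi> \<circ> \<gamma>) (at t)))"
  have flY: "flow_line K Y" and velY: "\<And>t. t \<in> K \<Longrightarrow> velocity M \<gamma> t = D (fst (Y t)) (snd (Y t))"
    using geodesic_flow_line[OF g(1)] by (simp_all add: K_def Y_def)
  have XS: "fst (X t) \<in> \<phi> ` U" if "t \<in> {0..1}" for t
    using flow_line_components(1)[OF fl] J(2) that by blast
  have gU: "\<beta> t \<in> U" and X\<beta>: "fst (X t) = \<phi> (\<beta> t)" if "t \<in> {0..1}" for t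
    using XS[OF that] by (simp_all add: \<beta>_def)
  define E where "E = {t\<in>{0..1}. \<gamma> t = \<beta> t}"
  define T where "T = {t\<in>E. Y t - X t = 0}"
  have EK: "E \<subseteq> K" using gU g(2) by (auto simp: E_def K_def)
  have "closed E"
  proof -
    have cm: "continuous_map (top_of_set {0..1}) (mtop M) \<gamma>" "continuous_map (top_of_set {0..1}) (mtop M) \<beta>"
      using g flow_line_geodesic(1)[OF fl J(1)] J(2)
      by (auto simp: geodesic_def smooth_curve_def \<beta>_def intro: continuous_map_from_subtopology_mono)
    have "Hausdorff_space (mtop M)" using M by (simp add: immersed_submanifold_def smooth_manifold_def)
    from closedin_continuous_maps_eq[OF this cm] show ?thesis
      using closedin_closed_trans[of "{0..1}" E] by (simp add: E_def)
  qed
  moreover have "continuous_on E (\<lambda>t. Y t - X t)"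
  proof (rule continuous_at_imp_continuous_on, rule ballI)
    fix t assume "t \<in> E"
    then have "t \<in> K" "t \<in> J" using EK J(2) by (auto simp: E_def)
    then show "isCont (\<lambda>t. Y t - X t) t"
      using flY fl by (intro continuous_diff) (auto simp: flow_line_def intro: has_vector_derivative_continuous)
  qed
  ultimately have "closed T"
    unfolding T_def by (intro continuous_closed_preimage_constant)
  then have "closedin (top_of_set {0..1}) T"
    by (rule closed_subset[rotated]) (auto simp: T_def E_def)
  moreover have "openin (top_of_set {0..1}) T"
    unfolding openin_subtopology_self openin_contains_ball
  proof (intro conjI ballI)
    show "T \<subseteq> {0..1}" by (auto simp: T_def E_def)
    fix t assume t: "t \<in> T"
    then have tKJ: "t \<in> K \<inter> J" and eq: "Y t = X t" using EK J(2) by (auto simp: T_def E_def)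
    have op: "open (K \<inter> J)" using flY fl by (auto simp: flow_line_def)
    obtain d where d: "d > 0" "ball t d \<subseteq> K \<inter> J" "\<And>s. s \<in> ball t d \<Longrightarrow> Y s = X s"
      by (rule ode_local_uniqueness[OF open_TS smooth_onD[OF smooth_spray] op tKJ, of Y X])
        (use flY fl eq that in \<open>auto simp: flow_line_def\<close>)
    have "ball t d \<inter> {0..1} \<subseteq> T"
    proof
      fix s assume s: "s \<in> ball t d \<inter> {0..1}"
      then have "Y s = X s" and "s \<in> K" using d by auto
      have "\<phi> (\<gamma> s) = fst (Y s)" by (simp add: Y_def)
      also have "\<dots> = \<phi> (\<beta> s)" using X\<beta>[of s] s \<open>Y s = X s\<close> by simp
      finally have "\<phi> (\<gamma> s) = \<phi> (\<beta> s)" .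
      moreover have "\<gamma> s \<in> U" using \<open>s \<in> K\<close> by (simp add: K_def)
      ultimately have "\<gamma> s = \<beta> s" using inj_onD[OF inj_chart _ _ gU] s by auto
      then show "s \<in> T" using s \<open>Y s = X s\<close> by (simp add: T_def E_def)
    qed
    then show "\<exists>e>0. ball t e \<inter> {0..1} \<subseteq> T" using d(1) by blast
  qed
  moreover have "0 \<in> T"
  proof -
    have 0: "0 \<in> E" using \<gamma>0 by (simp add: E_def \<beta>_def)
    then have "0 \<in> K" using EK by blast
    have fst0: "fst (Y 0) = fst (X 0)" using \<gamma>0 XS[of 0] by (simp add: Y_def)
    then have "snd (Y 0) = snd (X 0)"
      using velY[OF \<open>0 \<in> K\<close>] vel0 inj_D[OF XS[of 0]] by simp
    then show ?thesis using 0 fst0 by (simp add: T_def prod_eq_iff)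
  qed
  ultimately have "T = {0..1}"
    using connected_clopen[of "{0..1::real}"] by auto
  then have "1 \<in> T" by simp
  then show ?thesis by (simp add: T_def E_def \<beta>_def)
qed

lemma exp_map_chart:
  assumes p: "p \<in> U" and fl: "flow_line J X" "is_interval J" "{0..1} \<subseteq> J"
    and X0: "X 0 = (\<phi> p, w)"
  shows "exp_reaches M p (D (\<phi> p) w) (\<psi> (fst (X 1)))"
    and "exp_map M p (D (\<phi> p) w) = \<psi> (fst (X 1))"
proof -
  have "0 \<in> J" using fl(3) by auto
  show r: "exp_reaches M p (D (\<phi> p) w) (\<psi> (fst (X 1)))"
    unfolding exp_reaches_def
    using flow_line_geodesic[OF fl(1,2)] \<open>0 \<in> J\<close> fl(3) X0 p
    by (intro exI[of _ J] exI[of _ "\<lambda>t. \<psi> (fst (X t))"]) simp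
  show "exp_map M p (D (\<phi> p) w) = \<psi> (fst (X 1))"
    unfolding exp_map_def
  proof (rule the_equality, rule r)
    fix q assume "exp_reaches M p (D (\<phi> p) w) q"
    then obtain I \<gamma> where "geodesic M I \<gamma>" "{0..1} \<subseteq> I" "\<gamma> 0 = p" "velocity M \<gamma> 0 = D (\<phi> p) w" "\<gamma> 1 = q"
      unfolding exp_reaches_def by blast
    then show "q = \<psi> (fst (X 1))"
      using geodesic_unique[OF fl, of I \<gamma>] X0 p by simp
  qed
qed

end

section \<open>The expansion of the exponential map\<close>

lemma orthonormal_span_expansion:
  fixes t :: "'i::finite \<Rightarrow> 'a::real_inner"
  assumes "\<And>i j. t i \<bullet> t j = (if i = j then 1 else 0)" "z \<in> span (range t)"
  shows "z = (\<Sum>i\<in>UNIV. (z \<bullet> t i) *\<^sub>R t i)"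
  using assms(2)
proof (induction rule: span_induct_alt)
  case base
  show ?case by simp
next
  case (step c x y)
  then obtain j where x: "x = t j" by auto
  have "(\<Sum>i\<in>UNIV. (t j \<bullet> t i) *\<^sub>R t i) = t j"
    by (simp add: assms(1) if_distrib[of "\<lambda>r. r *\<^sub>R _"] cong: if_cong)
  then show ?case using step(2)
    by (simp add: x inner_add_left scaleR_left_distrib sum.distrib flip: scaleR_scaleR scaleR_sum_right)
qed

theorem mainTheorem1:
  fixes M :: "('m, 'k::finite, 'n::finite) submanifold"
    and m :: 'm
    and t :: "'k \<Rightarrow> real^'n"
  assumes "immersed_submanifold M"
    and "m \<in> topspace (mtop M)"
    and "\<And>i j. t i \<bullet> t j = (if i = j then 1 else 0)"
    and "span (range t) = tangent_space M m"
  shows "(\<exists>\<delta>>0. tangent_space M m \<inter> ball 0 \<delta> \<subseteq> exp_domain M m) \<and>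
    (\<lambda>x. norm (imm M (exp_map M m x) -
        (imm M m + x + (1/2) *\<^sub>R second_ff M m x x
         - (1/6) *\<^sub>R (\<Sum>i\<in>UNIV. (second_ff M m (t i) x \<bullet> second_ff M m x x) *\<^sub>R t i)
         + (1/6) *\<^sub>R cov_second_ff M m x x x)))
      \<in> O[inf (nhds 0) (principal (tangent_space M m))](\<lambda>x. norm x ^ 4)"
proof -
  have "(\<Union>(U, \<phi>)\<in>atlas M. U) = topspace (mtop M)"
    using assms(1) by (simp add: immersed_submanifold_def smooth_manifold_def)
  then obtain U \<phi> where chart: "(U, \<phi>) \<in> atlas M" and m: "m \<in> U" using assms(2) by blast
  interpret immersed_chart M U \<phi> using assms(1) chart by unfold_locales
  define u where "u = \<phi> m"
  have u: "u \<in> \<phi> ` U" using m by (simp add: u_def)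
  obtain \<rho> C where \<rho>: "\<rho> > 0" and C: "C \<ge> 0" and family: "\<And>w. norm w < \<rho> \<Longrightarrow>
    \<exists>J X. is_interval J \<and> {0..1} \<subseteq> J \<and> flow_line J X \<and> X 0 = (u, w) \<and>
    norm ((imm M \<circ> \<psi>) (fst (X 1)) - ((imm M \<circ> \<psi>) u + D u w + (1/2) *\<^sub>R sff u (D u w) (D u w)
      + (1/6) *\<^sub>R (dsff u w (D u w) (D u w) - tproj u (dsff u w (D u w) (D u w))
          - dtproj u w (sff u (D u w) (D u w))))) \<le> C * norm w ^ 4"
    using geodesic_family[OF u] by blast
  obtain K where K: "K > 0" "\<And>x. norm (pinv u x) \<le> K * norm x"
    using linear_bounded_pos[OF linear_pinv[OF u]] by blast
  have small: "norm (pinv u x) < \<rho>" if "norm x < \<rho> / K" for x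
    using K(2)[of x] that K(1) by (simp add: pos_less_divide_eq mult.commute)
  have DB: "D u (pinv u x) = x" if "x \<in> tangent_space M m" for x
    using D_pinv_tangent[OF m that] by (simp add: u_def)
  have tan: "tproj u (t i) = t i" for i
    using assms(4) span_base[of "t i" "range t"] tangent_space_iff[OF m] by (simp add: u_def)
  have main: "x \<in> exp_domain M m \<and> norm (imm M (exp_map M m x) -
        (imm M m + x + (1/2) *\<^sub>R second_ff M m x x
         - (1/6) *\<^sub>R (\<Sum>i\<in>UNIV. (second_ff M m (t i) x \<bullet> second_ff M m x x) *\<^sub>R t i)
         + (1/6) *\<^sub>R cov_second_ff M m x x x)) \<le> (C * K ^ 4) * norm x ^ 4"
    if x: "x \<in> tangent_space M m" and xs: "norm x < \<rho> / K" for x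
  proof -
    let ?w = "pinv u x" and ?\<alpha> = "sff u x x" and ?d = "dsff u (pinv u x) x x"
    obtain J X where X: "is_interval J" "{0..1} \<subseteq> J" "flow_line J X" "X 0 = (u, ?w)"
      and bound: "norm ((imm M \<circ> \<psi>) (fst (X 1)) - ((imm M \<circ> \<psi>) u + x + (1/2) *\<^sub>R ?\<alpha>
      + (1/6) *\<^sub>R (?d - tproj u ?d - dtproj u ?w ?\<alpha>))) \<le> C * norm ?w ^ 4"
      using family[OF small[OF xs]] unfolding DB[OF x] by blast
    note e = exp_map_chart[OF m X(3,1,2,4)[unfolded u_def], folded u_def, unfolded DB[OF x]]
    have Px: "tproj u x = x" using x tangent_space_iff[OF m] by (simp add: u_def)
    have tproj_\<alpha>: "tproj u ?\<alpha> = 0" unfolding sff_def by (rule tproj_dtproj_tangent[OF u Px])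
    have ff_eq: "second_ff M m a b = sff u a b" if "tproj u a = a" "tproj u b = b" for a b
      using second_ff_chart[OF m] that tangent_space_iff[OF m] by (simp add: u_def)
    have "dtproj u ?w ?\<alpha> \<in> span (range t)"
      unfolding assms(4) using tangent_space_iff[OF m] tproj_dtproj_normal[OF u tproj_\<alpha>] by (simp add: u_def)
    then have "dtproj u ?w ?\<alpha> = (\<Sum>i\<in>UNIV. (dtproj u ?w ?\<alpha> \<bullet> t i) *\<^sub>R t i)"
      by (rule orthonormal_span_expansion[OF assms(3)])
    also have "\<dots> = (\<Sum>i\<in>UNIV. (second_ff M m (t i) x \<bullet> second_ff M m x x) *\<^sub>R t i)"
    proof (rule sum.cong[OF refl])
      fix i
      have "second_ff M m (t i) x = dtproj u ?w (t i)"
        using sff_symmetric[OF u tan[of i] Px] by (simp add: ff_eq tan Px sff_def)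
      then show "(dtproj u ?w ?\<alpha> \<bullet> t i) *\<^sub>R t i = (second_ff M m (t i) x \<bullet> second_ff M m x x) *\<^sub>R t i"
        using dtproj_symmetric[OF u, of ?w ?\<alpha> "t i"] by (simp add: ff_eq Px inner_commute)
    qed
    finally have s: "dtproj u ?w ?\<alpha> = (\<Sum>i\<in>UNIV. (second_ff M m (t i) x \<bullet> second_ff M m x x) *\<^sub>R t i)" .
    have c: "cov_second_ff M m x x x = ?d - tproj u ?d"
      using cov_second_ff_chart[OF m x x x] by (simp add: u_def)
    have eq: "a + y + z + (1/6) *\<^sub>R (d - e) = a + y + z - (1/6) *\<^sub>R e + (1/6) *\<^sub>R d"
      for a y z d e :: "real^'n" by (simp add: scaleR_right_diff_distrib)
    have "norm ?w ^ 4 \<le> (K * norm x) ^ 4" by (intro power_mono K(2)) simp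
    then have "C * norm ?w ^ 4 \<le> (C * K ^ 4) * norm x ^ 4"
      using mult_left_mono[OF _ C] by (simp add: power_mult_distrib mult.assoc)
    moreover have "(imm M \<circ> \<psi>) u = imm M m" using m by (simp add: u_def)
    ultimately have "norm (imm M (exp_map M m x) -
        (imm M m + x + (1/2) *\<^sub>R second_ff M m x x
         - (1/6) *\<^sub>R (\<Sum>i\<in>UNIV. (second_ff M m (t i) x \<bullet> second_ff M m x x) *\<^sub>R t i)
         + (1/6) *\<^sub>R cov_second_ff M m x x x)) \<le> (C * K ^ 4) * norm x ^ 4"
      using bound unfolding c e(2) ff_eq[OF Px Px] eq s[unfolded ff_eq[OF Px Px]] by simp
    then show ?thesis using x e(1) unfolding exp_domain_def by blast
  qed
  show ?thesis
  proof (intro conjI bigoI[where c="C * K ^ 4"])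
    show "\<exists>\<delta>>0. tangent_space M m \<inter> ball 0 \<delta> \<subseteq> exp_domain M m"
      using main \<rho> K(1) by (intro exI[of _ "\<rho> / K"]) auto
    show "\<forall>\<^sub>F x in inf (nhds 0) (principal (tangent_space M m)).
      norm (norm (imm M (exp_map M m x) -
        (imm M m + x + (1/2) *\<^sub>R second_ff M m x x
         - (1/6) *\<^sub>R (\<Sum>i\<in>UNIV. (second_ff M m (t i) x \<bullet> second_ff M m x x) *\<^sub>R t i)
         + (1/6) *\<^sub>R cov_second_ff M m x x x))) \<le> (C * K ^ 4) * norm (norm x ^ 4)"
      unfolding eventually_inf_principal eventually_nhds_metric
      using main \<rho> K(1) by (intro exI[of _ "\<rho> / K"]) auto
  qed
qed

end
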